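(* For all integers $n\geq 3$ and $r$ with $\frac{n}{3}\leq r<\frac{n}{2}$, $$\mathrm{Cl}(C_n^r)\simeq\Sigma^2\,\mathrm{Cl}\bigl(C_{4r-n}^{\,3r-n}\bigr)=\Sigma^2\,\mathrm{Cl}\bigl(C_{n-2(n-2r)}^{\,r-(n-2r)}\bigr).$$
   Context: $C_m$ is the cycle with $m$ vertices. $G^r$ denotes the $r$-th distance power of a graph $G$: the graph on $V(G)$ in which two distinct vertices are adjacent iff their distance in $G$ is at most $r$; $G^0$ is the graph on $V(G)$ with no edges. (When $m=4r-n\in\{1,2\}$ the exponent $3r-n$ is $0$, and $C_m^0$ means the graph with $m$ vertices and no edges.) The clique complex $\mathrm{Cl}(G)$ is the simplicial complex on $V(G)$ whose simplices are the cliques of $G$. $\Sigma K=S^0\ast K$ is the unreduced suspension and $\Sigma^2=\Sigma\Sigma$. *)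

theory Defs
  imports
    "Graph_Theory.Pair_Digraph"
    "Graph_Theory.Shortest_Path"
    "HOL-Analysis.Analysis"
begin

text \<open>
  Finite simple graphs are symmetric loop-free arc relations, i.e. records satisfying
  \<^locale>\<open>pair_graph\<close>: an edge between \<open>u\<close> and \<open>v\<close> is represented by the two
  arcs \<open>(u, v)\<close> and \<open>(v, u)\<close>.
\<close>

text \<open>
  For \<open>m \<ge> 3\<close> this is the usual cycle with \<open>m\<close> vertices. The condition
  \<open>i \<noteq> j\<close> only matters for \<open>m = 1\<close>, where it excludes a loop; for
  \<open>m = 2\<close> the graph is a single edge.
\<close>

definition cycle_graph :: "nat \<Rightarrow> nat pair_pre_digraph" where
  "cycle_graph m =
    \<lparr>pverts = {0..<m},
     parcs = {(i, j). i < m \<and> j < m \<and> i \<noteq> j \<and>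
                (j = (i + 1) mod m \<or> i = (j + 1) mod m)}\<rparr>"

lemma pair_graph_cycle_graph: "pair_graph (cycle_graph m)"
proof
  have "parcs (cycle_graph m) \<subseteq> {0..<m} \<times> {0..<m}"
    by (auto simp: cycle_graph_def)
  then show "finite (parcs (cycle_graph m))"
    by (rule finite_subset) simp
qed (auto simp: cycle_graph_def symmetric_def arcs_ends_def arc_to_ends_def intro!: symI)

text \<open>
  With all arcs of weight 1, the cheapest-walk cost \<^const>\<open>wf_digraph.\<mu>\<close> is the
  usual graph distance (\<open>\<infinity>\<close> between different components).
\<close>

definition graph_dist :: "'a pair_pre_digraph \<Rightarrow> 'a \<Rightarrow> 'a \<Rightarrow> ereal" where
  "graph_dist G u v = wf_digraph.\<mu> (with_proj G) (\<lambda>_. 1) u v"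

definition graph_power :: "'a pair_pre_digraph \<Rightarrow> nat \<Rightarrow> 'a pair_pre_digraph" where
  "graph_power G r =
    \<lparr>pverts = pverts G,
     parcs = {(u, v). u \<in> pverts G \<and> v \<in> pverts G \<and> u \<noteq> v \<and>
                graph_dist G u v \<le> ereal (real r)}\<rparr>"

lemma pair_graph_graph_power:
  assumes "pair_graph G"
  shows "pair_graph (graph_power G r)"
proof -
  interpret pair_graph G by fact
  have sym: "graph_dist G u v = graph_dist G v u" for u v
  proof -
    have le: "\<mu> (\<lambda>_. 1) u v \<le> \<mu> (\<lambda>_. 1) v u" for u v
    proof (unfold \<mu>_def, rule INF_greatest, simp)
      fix p assume p: "awalk v p u"
      have "awalk u (map prod.swap (rev p)) v"
        using p
      proof (induction p arbitrary: v)
        case Nil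
        then show ?case by (auto simp: awalk_Nil_iff)
      next
        case (Cons e p)
        then have e: "e \<in> parcs G" "fst e = v" and w: "awalk (snd e) p u"
          by (auto simp: awalk_Cons_iff)
        have "prod.swap e \<in> parcs G"
          using e arcs_symmetric by (cases e) auto
        then have "awalk (snd e) [prod.swap e] v"
          using e by (cases e) (auto simp: awalk_Cons_iff awalk_Nil_iff dest: in_arcsD1 in_arcsD2)
        with Cons.IH[OF w] show ?case
          by (auto intro: awalk_appendI)
      qed
      then have "(INF p\<in>{p. awalk u p v}. ereal (awalk_cost (\<lambda>_. 1) p))
          \<le> ereal (awalk_cost (\<lambda>_. 1) (map prod.swap (rev p)))"
        by (intro INF_lower) simp
      also have "\<dots> = ereal (awalk_cost (\<lambda>_. 1) p)"
        by (simp add: awalk_cost_def sum_list_triv)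
      finally show "(INF p\<in>{p. awalk u p v}. ereal (awalk_cost (\<lambda>_. 1) p))
          \<le> ereal (awalk_cost (\<lambda>_. 1) p)" .
    qed
    show ?thesis
      unfolding graph_dist_def by (intro antisym le)
  qed
  show ?thesis
  proof
    have "parcs (graph_power G r) \<subseteq> pverts G \<times> pverts G"
      by (auto simp: graph_power_def)
    then show "finite (parcs (graph_power G r))"
      by (rule finite_subset) simp
  qed (auto simp: graph_power_def sym symmetric_def arcs_ends_def arc_to_ends_def intro!: symI)
qed

lemma graph_dist_le_iff:
  assumes "pair_graph G"
  shows "graph_dist G u v \<le> ereal (real k) \<longleftrightarrow>
    (\<exists>p. pre_digraph.awalk (with_proj G) u p v \<and> length p \<le> k)"
proof -
  interpret pair_graph G by fact
  have cost: "awalk_cost (\<lambda>_. 1) p = real (length p)" for p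
    by (simp add: awalk_cost_def sum_list_triv)
  show ?thesis
  proof
    assume "graph_dist G u v \<le> ereal (real k)"
    also have "ereal (real k) < ereal (real k + 1)" by simp
    finally obtain p where "awalk u p v" "real (length p) < real k + 1"
      unfolding graph_dist_def \<mu>_def cost by (auto simp: INF_less_iff)
    then show "\<exists>p. awalk u p v \<and> length p \<le> k"
      by (intro exI[of _ p]) linarith
  next
    assume "\<exists>p. awalk u p v \<and> length p \<le> k"
    then obtain p where "awalk u p v" "length p \<le> k" by blast
    then show "graph_dist G u v \<le> ereal (real k)"
      unfolding graph_dist_def \<mu>_def cost
      by (intro INF_lower2[of p]) auto
  qed
qed

lemma parcs_graph_power_0:
  assumes "pair_graph G"
  shows "parcs (graph_power G 0) = {}"
proof -
  interpret pair_graph G by fact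
  show ?thesis
    using graph_dist_le_iff[OF assms, where k = 0]
    by (auto simp: graph_power_def awalk_Nil_iff)
qed

text \<open>
  An abstract simplicial complex is given by its set of finite simplices, which is closed under
  subsets; the empty simplex is included.
\<close>

definition clique_complex :: "'a pair_pre_digraph \<Rightarrow> 'a set set" where
  "clique_complex G =
    {\<sigma>. finite \<sigma> \<and> \<sigma> \<subseteq> pverts G \<and>
        (\<forall>u\<in>\<sigma>. \<forall>v\<in>\<sigma>. u \<noteq> v \<longrightarrow> (u, v) \<in> parcs G)}"

text \<open>
  Since the empty simplex belongs to each factor, both factors are subcomplexes of the join.
\<close>

definition simplicial_join :: "'a set set \<Rightarrow> 'b set set \<Rightarrow> ('a + 'b) set set" where
  "simplicial_join K L = {\<sigma> <+> \<tau> | \<sigma> \<tau>. \<sigma> \<in> K \<and> \<tau> \<in> L}"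

definition two_points :: "bool set set" where
  "two_points = {{}, {False}, {True}}"

definition suspension :: "'a set set \<Rightarrow> (bool + 'a) set set" where
  "suspension K = simplicial_join two_points K"

text \<open>
  Points of the geometric realization are given by their barycentric coordinates. The set of
  points lying in the empty simplex is empty, because the empty sum is not 1.
\<close>

definition closed_simplex :: "'a set \<Rightarrow> ('a \<Rightarrow> real) set" where
  "closed_simplex \<sigma> =
    {x. (\<forall>v. 0 \<le> x v) \<and> (\<forall>v. v \<notin> \<sigma> \<longrightarrow> x v = 0) \<and> (\<Sum>v\<in>\<sigma>. x v) = 1}"

text \<open>
  The weak (coherent) topology: a set is open iff its trace on each closed simplex is relatively
  open. The topology of a single simplex is induced by the product topology on functions.
\<close>

definition geometric_realization :: "'a set set \<Rightarrow> ('a \<Rightarrow> real) topology" where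
  "geometric_realization K = topology (\<lambda>U.
     U \<subseteq> (\<Union>\<sigma>\<in>K. closed_simplex \<sigma>) \<and>
     (\<forall>\<sigma>\<in>K. openin (top_of_set (closed_simplex \<sigma>)) (U \<inter> closed_simplex \<sigma>)))"

lemma openin_geometric_realization:
  "openin (geometric_realization K) U \<longleftrightarrow>
     U \<subseteq> (\<Union>\<sigma>\<in>K. closed_simplex \<sigma>) \<and>
     (\<forall>\<sigma>\<in>K. openin (top_of_set (closed_simplex \<sigma>)) (U \<inter> closed_simplex \<sigma>))"
proof -
  have "istopology (\<lambda>U. U \<subseteq> (\<Union>\<sigma>\<in>K. closed_simplex \<sigma>) \<and>
     (\<forall>\<sigma>\<in>K. openin (top_of_set (closed_simplex \<sigma>)) (U \<inter> closed_simplex \<sigma>)))"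
    unfolding istopology_def
  proof (intro conjI allI impI ballI)
    fix S T \<sigma>
    assume S: "S \<subseteq> (\<Union>\<sigma>\<in>K. closed_simplex \<sigma>) \<and>
        (\<forall>\<sigma>\<in>K. openin (top_of_set (closed_simplex \<sigma>)) (S \<inter> closed_simplex \<sigma>))"
      and T: "T \<subseteq> (\<Union>\<sigma>\<in>K. closed_simplex \<sigma>) \<and>
        (\<forall>\<sigma>\<in>K. openin (top_of_set (closed_simplex \<sigma>)) (T \<inter> closed_simplex \<sigma>))"
      and "\<sigma> \<in> K"
    then have "openin (top_of_set (closed_simplex \<sigma>))
        ((S \<inter> closed_simplex \<sigma>) \<inter> (T \<inter> closed_simplex \<sigma>))"
      by blast
    then show "openin (top_of_set (closed_simplex \<sigma>)) (S \<inter> T \<inter> closed_simplex \<sigma>)"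
      by (simp add: Int_ac)
  next
    fix \<K> \<sigma>
    assume "\<forall>U\<in>\<K>. U \<subseteq> (\<Union>\<sigma>\<in>K. closed_simplex \<sigma>) \<and>
        (\<forall>\<sigma>\<in>K. openin (top_of_set (closed_simplex \<sigma>)) (U \<inter> closed_simplex \<sigma>))"
      and "\<sigma> \<in> K"
    then have "openin (top_of_set (closed_simplex \<sigma>)) (\<Union>U\<in>\<K>. U \<inter> closed_simplex \<sigma>)"
      by blast
    then show "openin (top_of_set (closed_simplex \<sigma>)) (\<Union>\<K> \<inter> closed_simplex \<sigma>)"
      by (simp add: Int_commute Int_Union)
  qed blast+
  then show ?thesis
    unfolding geometric_realization_def by (simp add: topology_inverse')
qed

lemma topspace_geometric_realization:
  "topspace (geometric_realization K) = (\<Union>\<sigma>\<in>K. closed_simplex \<sigma>)"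
proof (rule antisym)
  show "topspace (geometric_realization K) \<subseteq> (\<Union>\<sigma>\<in>K. closed_simplex \<sigma>)"
    using openin_geometric_realization openin_topspace by blast
  have "(\<Union>\<sigma>\<in>K. closed_simplex \<sigma>) \<inter> closed_simplex \<tau> = closed_simplex \<tau>" if "\<tau> \<in> K" for \<tau>
    using that by blast
  then have "openin (geometric_realization K) (\<Union>\<sigma>\<in>K. closed_simplex \<sigma>)"
    by (simp add: openin_geometric_realization)
  then show "(\<Union>\<sigma>\<in>K. closed_simplex \<sigma>) \<subseteq> topspace (geometric_realization K)"
    by (rule openin_subset)
qed

end

theory Submission
  imports Defs
begin

text \<open>
  Put \<open>d = n - 2 * r\<close>. A clique complex is the independence complex of the complement, and two
  vertices of the cycle are non-adjacent in the power iff both arcs between them are longer than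
  \<open>r\<close>. If the neighbours \<open>N\<close> of \<open>v\<close> form an independent set, then the independence
  complex is homotopy equivalent to the suspension of the complex of those \<open>\<sigma>\<close> away from
  \<open>v\<close> and \<open>N\<close> that leave some vertex of \<open>N\<close> free. Here each vertex leaves free an
  interval of \<open>N\<close>, so by Helly's theorem on the line this complex is an independence complex
  again. Doing this at \<open>0\<close> and then at \<open>r + d\<close> removes \<open>2 * d\<close> vertices and leaves the
  complement of the power of the shorter cycle with the same \<open>d\<close>.
\<close>

section \<open>Realizations of finite complexes\<close>

lemma closed_closed_simplex:
  shows "closed (closed_simplex \<sigma> :: ('a \<Rightarrow> real) set)"
proof -
  have eq: "closed_simplex \<sigma> = (\<Inter>v. {x. 0 \<le> x v}) \<inter> (\<Inter>v\<in>-\<sigma>. {x. x v = 0}) \<inter> {x. (\<Sum>v\<in>\<sigma>. x v) = 1}"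
    by (auto simp: closed_simplex_def)
  show ?thesis
    unfolding eq
    by (intro closed_Int closed_INT ballI closed_Collect_le closed_Collect_eq
        continuous_on_const continuous_on_sum continuous_on_product_coordinates)
qed

text \<open>With finitely many simplices, the part of the realization outside a weakly open set is a
  finite union of closed sets. Hence the weak topology is the one induced by the product topology,
  and from here on continuity can be checked coordinate by coordinate.\<close>

lemma geometric_realization_eq_top_of_set:
  assumes "finite K"
  shows "geometric_realization K = top_of_set (\<Union>\<sigma>\<in>K. closed_simplex \<sigma>)"
proof (rule topology_eq[THEN iffD2], intro allI iffI)
  fix U
  let ?S = "\<Union>\<sigma>\<in>K. closed_simplex \<sigma>"
  assume "openin (top_of_set ?S) U"
  then obtain T where "open T" "U = ?S \<inter> T"
    by (auto simp: openin_open)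
  moreover from this have "U \<inter> closed_simplex \<sigma> = closed_simplex \<sigma> \<inter> T" if "\<sigma> \<in> K" for \<sigma>
    using that by blast
  ultimately show "openin (geometric_realization K) U"
    by (auto simp: openin_geometric_realization openin_open)
next
  fix U
  let ?S = "\<Union>\<sigma>\<in>K. closed_simplex \<sigma>"
  assume U: "openin (geometric_realization K) U"
  have "closed (closed_simplex \<sigma> - U)" if \<sigma>: "\<sigma> \<in> K" for \<sigma>
  proof -
    have "openin (top_of_set (closed_simplex \<sigma>)) (U \<inter> closed_simplex \<sigma>)"
      using U \<sigma> by (auto simp: openin_geometric_realization)
    then have "closedin (top_of_set (closed_simplex \<sigma>)) (closed_simplex \<sigma> - U \<inter> closed_simplex \<sigma>)"
      by (metis closedin_diff closedin_topspace topspace_euclidean_subtopology)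
    then show ?thesis
      using closed_closed_simplex by (metis Diff_Int2 Diff_Int_distrib2 closedin_closed_eq inf.idem)
  qed
  then have "closed (\<Union>\<sigma>\<in>K. closed_simplex \<sigma> - U)"
    using assms by blast
  moreover have "U = ?S \<inter> - (\<Union>\<sigma>\<in>K. closed_simplex \<sigma> - U)"
    using U by (auto simp: openin_geometric_realization)
  ultimately show "openin (top_of_set ?S) U"
    by (metis open_Compl openin_open)
qed

definition finite_complex :: "'a set set \<Rightarrow> bool" where
  "finite_complex K \<longleftrightarrow> finite K \<and> (\<forall>\<sigma>\<in>K. finite \<sigma>) \<and> (\<forall>\<sigma>\<in>K. \<forall>\<tau>. \<tau> \<subseteq> \<sigma> \<longrightarrow> \<tau> \<in> K)"

lemma closed_simplex_mono:
  assumes "finite \<tau>" and "\<sigma> \<subseteq> \<tau>" and "x \<in> closed_simplex \<sigma>"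
  shows "x \<in> closed_simplex \<tau>"
proof -
  have "(\<Sum>v\<in>\<tau>. x v) = (\<Sum>v\<in>\<sigma>. x v)"
    using assms by (intro sum.mono_neutral_right) (auto simp: closed_simplex_def)
  then show ?thesis
    using assms by (auto simp: closed_simplex_def)
qed

lemma closed_simplex_remove_zero:
  assumes "finite \<sigma>" and "x \<in> closed_simplex \<sigma>" and "x v = 0"
  shows "x \<in> closed_simplex (\<sigma> - {v})"
proof -
  have "(\<Sum>u\<in>\<sigma>. x u) = (\<Sum>u\<in>\<sigma>-{v}. x u)"
    using assms by (intro sum.mono_neutral_right) (auto simp: closed_simplex_def)
  then show ?thesis
    using assms by (auto simp: closed_simplex_def)
qed

lemma closed_simplex_convex:
  assumes "x \<in> closed_simplex \<sigma>" and "y \<in> closed_simplex \<sigma>" and "0 \<le> t" and "t \<le> 1"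
  shows "(\<lambda>v. (1 - t) * x v + t * y v) \<in> closed_simplex \<sigma>"
proof -
  have "(\<Sum>v\<in>\<sigma>. (1 - t) * x v + t * y v) = 1"
    using assms by (simp add: sum.distrib closed_simplex_def flip: sum_distrib_left)
  then show ?thesis
    using assms by (auto simp: closed_simplex_def)
qed

section \<open>Collapses of finite complexes\<close>

lemma continuous_on_Min_coordinates:
  assumes "finite \<tau>" and "\<tau> \<noteq> {}"
  shows "continuous_on S (\<lambda>x :: 'a \<Rightarrow> real. Min (x ` \<tau>))"
  using assms
proof (induction \<tau> rule: finite_ne_induct)
  case (singleton v)
  then show ?case
    by (auto intro: continuous_on_subset[OF continuous_on_product_coordinates])
next
  case (insert v \<tau>)
  have "Min (x ` insert v \<tau>) = min (x v) (Min (x ` \<tau>))" for x :: "'a \<Rightarrow> real"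
    using insert by simp
  then show ?case
    using insert.IH
    by (auto intro!: continuous_on_min intro: continuous_on_subset[OF continuous_on_product_coordinates])
qed

text \<open>
  The retraction moves the weight \<open>m = min {x i | i \<in> \<tau>}\<close> from each vertex of \<open>\<tau>\<close>
  to the apex \<open>w\<close>.
\<close>

lemma homotopy_equivalent_dominated_collapse:
  assumes K: "finite_complex K" and ne: "\<tau> \<noteq> {}" and fin: "finite \<tau>" and w: "w \<notin> \<tau>"
    and dom: "\<And>\<sigma>. \<sigma> \<in> K \<Longrightarrow> \<tau> \<subseteq> \<sigma> \<Longrightarrow> insert w \<sigma> \<in> K"
  shows "geometric_realization K homotopy_equivalent_space
    geometric_realization {\<sigma> \<in> K. \<not> \<tau> \<subseteq> \<sigma>}"
proof -
  let ?L = "{\<sigma> \<in> K. \<not> \<tau> \<subseteq> \<sigma>}"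
  let ?S = "\<Union>\<sigma>\<in>K. closed_simplex \<sigma>" and ?T = "\<Union>\<sigma>\<in>?L. closed_simplex \<sigma>"
  define m where "m x = Min (x ` \<tau>)" for x :: "'a \<Rightarrow> real"
  define f where "f x v = x v - (if v \<in> \<tau> then m x else 0) + (if v = w then real (card \<tau>) * m x else 0)"
    for x :: "'a \<Rightarrow> real" and v
  have m_le: "m x \<le> x v" if "v \<in> \<tau>" for x v
    using that fin by (simp add: m_def)
  have m_attained: "\<exists>v\<in>\<tau>. x v = m x" for x
  proof -
    have "Min (x ` \<tau>) \<in> x ` \<tau>"
      using ne fin by (intro Min_in) auto
    then show ?thesis
      by (auto simp: m_def)
  qed
  have L_sub: "?T \<subseteq> ?S"
    by blast
  have fixed: "f x = x" if "m x = 0" for x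
    using that by (auto simp: f_def)
  \<comment> \<open>A common carrier \<open>\<rho>\<close> of \<open>x\<close> and
    \<open>f x\<close> keeps the segment between them inside the realization, as the straight-line
    homotopy below requires.\<close>
  have simplex: "\<exists>\<rho>\<in>K. x \<in> closed_simplex \<rho> \<and> f x \<in> closed_simplex \<rho> \<and> f x \<in> ?T" if "x \<in> ?S" for x
  proof -
    obtain \<sigma> where \<sigma>: "\<sigma> \<in> K" "x \<in> closed_simplex \<sigma>"
      using \<open>x \<in> ?S\<close> by blast
    have fin\<sigma>: "finite \<sigma>" and down: "\<And>\<rho>. \<rho> \<subseteq> \<sigma> \<Longrightarrow> \<rho> \<in> K"
      using K \<sigma> by (auto simp: finite_complex_def)
    have nonneg: "0 \<le> x v" for v
      using \<sigma> by (simp add: closed_simplex_def)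
    \<comment> \<open>A vertex attaining the minimum has weight 0 in \<open>f x\<close>, so it can
      be deleted from the carrier, which then no longer contains \<open>\<tau>\<close>.\<close>
    obtain i where i: "i \<in> \<tau>" "x i = m x"
      using m_attained by blast
    show ?thesis
    proof (cases "m x = 0")
      case True
      have "x \<in> closed_simplex (\<sigma> - {i})"
        using closed_simplex_remove_zero fin\<sigma> \<sigma> i True by metis
      moreover have "\<sigma> - {i} \<in> ?L"
        using down i by blast
      ultimately have "x \<in> ?T"
        by blast
      then show ?thesis
        using \<sigma> True fixed by auto
    next
      case False
      then have pos: "0 < m x"
        using nonneg[of i] i by simp
      have "\<tau> \<subseteq> \<sigma>"
      proof
        fix v assume "v \<in> \<tau>"
        then have "x v \<noteq> 0"
          using m_le[of v x] pos by auto
        then show "v \<in> \<sigma>"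
          using \<sigma> by (auto simp: closed_simplex_def)
      qed
      let ?\<rho> = "insert w \<sigma>"
      have \<rho>: "?\<rho> \<in> K" "finite ?\<rho>"
        using dom \<sigma> \<open>\<tau> \<subseteq> \<sigma>\<close> fin\<sigma> by auto
      have x\<rho>: "x \<in> closed_simplex ?\<rho>"
        using closed_simplex_mono[OF \<rho>(2) _ \<sigma>(2)] by blast
      have "(\<Sum>v\<in>?\<rho>. f x v) = (\<Sum>v\<in>?\<rho>. x v) - (\<Sum>v\<in>?\<rho>. if v \<in> \<tau> then m x else 0)
          + (\<Sum>v\<in>?\<rho>. if v = w then real (card \<tau>) * m x else 0)"
        by (simp add: f_def sum.distrib sum_subtractf)
      also have "(\<Sum>v\<in>?\<rho>. if v \<in> \<tau> then m x else 0) = (\<Sum>v\<in>\<tau>. m x)"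
        using \<rho> \<open>\<tau> \<subseteq> \<sigma>\<close> by (intro sum.mono_neutral_cong_right) auto
      also have "(\<Sum>v\<in>?\<rho>. if v = w then real (card \<tau>) * m x else 0) = real (card \<tau>) * m x"
        using \<rho> by (subst sum.delta) auto
      also have "(\<Sum>v\<in>?\<rho>. x v) = 1"
        using x\<rho> by (simp add: closed_simplex_def)
      finally have sum1: "(\<Sum>v\<in>?\<rho>. f x v) = 1"
        by simp
      have "0 \<le> f x v" for v
        using nonneg[of v] m_le[of v x] pos by (auto simp: f_def)
      moreover have "f x v = 0" if "v \<notin> ?\<rho>" for v
        using that x\<rho> \<open>\<tau> \<subseteq> \<sigma>\<close> by (auto simp: f_def closed_simplex_def)
      ultimately have f\<rho>: "f x \<in> closed_simplex ?\<rho>"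
        using sum1 by (auto simp: closed_simplex_def)
      have "f x i = 0"
        using i w by (auto simp: f_def)
      then have "f x \<in> closed_simplex (?\<rho> - {i})"
        using closed_simplex_remove_zero \<rho> f\<rho> by metis
      moreover have "?\<rho> - {i} \<in> ?L"
        using K \<rho> i unfolding finite_complex_def by blast
      ultimately have "f x \<in> ?T"
        by blast
      then show ?thesis
        using \<rho> x\<rho> f\<rho> by blast
    qed
  qed
  \<comment> \<open>A carrier that omits a vertex of \<open>\<tau>\<close> forces the minimum to be
    0, so \<open>f\<close> fixes \<open>?T\<close> pointwise.\<close>
  have m0: "m x = 0" if "x \<in> ?T" for x
  proof -
    obtain \<sigma> v where "\<sigma> \<in> K" "v \<in> \<tau>" "v \<notin> \<sigma>" "x \<in> closed_simplex \<sigma>"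
      using \<open>x \<in> ?T\<close> by blast
    then have "x v = 0" "\<And>u. 0 \<le> x u"
      by (auto simp: closed_simplex_def)
    then show ?thesis
      using m_le[OF \<open>v \<in> \<tau>\<close>, of x] m_attained[of x] by (metis order_antisym)
  qed
  have cont_f: "continuous_on A f" for A
  proof (rule continuous_on_coordinatewise_then_product)
    fix v
    have "continuous_on A m" "continuous_on A (\<lambda>x. x v)"
      unfolding m_def by (rule continuous_on_Min_coordinates[OF fin ne])
        (rule continuous_on_subset[OF continuous_on_product_coordinates subset_UNIV])
    then show "continuous_on A (\<lambda>x. f x v)"
      unfolding f_def by (cases "v \<in> \<tau>"; cases "v = w"; simp; intro continuous_intros)
  qed
  have top: "geometric_realization K = top_of_set ?S" "geometric_realization ?L = top_of_set ?T"
    using K by (auto intro!: geometric_realization_eq_top_of_set simp: finite_complex_def)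
  have "homotopic_with (\<lambda>_. True) (top_of_set ?S) (top_of_set ?S) id f"
    unfolding homotopic_with_def
  proof (intro exI conjI allI)
    let ?h = "\<lambda>(t, x) v. (1 - t) * x v + t * f x v"
    have "continuous_on ({0..1} \<times> ?S) (\<lambda>p :: real \<times> ('a \<Rightarrow> real). f (snd p) v)" for v
      by (rule continuous_on_product_then_coordinatewise)
        (intro continuous_on_compose2[OF cont_f[of UNIV]] continuous_intros, simp)
    moreover have "continuous_on ({0..1} \<times> ?S) (\<lambda>p :: real \<times> ('a \<Rightarrow> real). snd p v)" for v
      by (rule continuous_on_product_then_coordinatewise) (intro continuous_intros)
    ultimately have "continuous_on ({0..1} \<times> ?S) ?h"
      unfolding split_beta
      by (intro continuous_on_coordinatewise_then_product continuous_intros)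
    moreover have "?h p \<in> ?S" if "p \<in> {0..1} \<times> ?S" for p
    proof -
      have p: "0 \<le> fst p" "fst p \<le> 1" "snd p \<in> ?S"
        using that by auto
      obtain \<rho> where \<rho>: "\<rho> \<in> K" "snd p \<in> closed_simplex \<rho>" "f (snd p) \<in> closed_simplex \<rho>"
        using simplex[OF p(3)] by blast
      have "?h p \<in> closed_simplex \<rho>"
        unfolding split_beta by (rule closed_simplex_convex[OF \<rho>(2,3) p(1,2)])
      then show ?thesis
        by (rule UN_I[OF \<rho>(1)])
    qed
    ultimately show "continuous_map (prod_topology (top_of_set {0..1}) (top_of_set ?S)) (top_of_set ?S) ?h"
      by (simp add: prod_topology_subtopology_eu image_subset_iff del: UN_iff)
  qed (auto simp: id_def)
  then have "homotopic_with (\<lambda>_. True) (top_of_set ?S) (top_of_set ?S) f id"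
    by (rule homotopic_with_symD)
  moreover have "retraction_maps (top_of_set ?S) (top_of_set ?T) f id"
    unfolding retraction_maps_def
  proof (intro conjI ballI)
    have "f x \<in> ?T" if "x \<in> ?S" for x
      using simplex[OF that] by blast
    then show "continuous_map (top_of_set ?S) (top_of_set ?T) f"
      using cont_f by (simp add: image_subset_iff del: UN_iff)
    show "continuous_map (top_of_set ?T) (top_of_set ?S) id"
      using L_sub by (auto simp: id_def)
    show "f (id x) = x" if "x \<in> topspace (top_of_set ?T)" for x
      using that fixed m0 by (simp del: UN_iff)
  qed
  ultimately show ?thesis
    unfolding top by (rule deformation_retract_imp_homotopy_equivalent_space)
qed

text \<open>
  The simplices of \<open>B\<close> are matched by toggling the vertex \<open>w (\<rho> - Y)\<close>. The matching is
  acyclic because toggling a vertex of \<open>Y\<close> leaves \<open>\<rho> - Y\<close> unchanged.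
\<close>

lemma homotopy_equivalent_matching_collapse:
  assumes "finite_complex K" and "B \<subseteq> K" and "{} \<notin> B"
    and "\<And>\<rho> \<sigma>. \<rho> \<in> B \<Longrightarrow> \<sigma> \<in> K \<Longrightarrow> \<rho> \<subseteq> \<sigma> \<Longrightarrow> \<sigma> \<in> B"
    and wY: "\<And>\<rho>. \<rho> \<in> B \<Longrightarrow> w (\<rho> - Y) \<in> Y"
    and "\<And>\<rho>. \<rho> \<in> B \<Longrightarrow> insert (w (\<rho> - Y)) \<rho> \<in> K"
    and "\<And>\<rho>. \<rho> \<in> B \<Longrightarrow> \<rho> - {w (\<rho> - Y)} \<in> B"
  shows "geometric_realization K homotopy_equivalent_space geometric_realization (K - B)"
  using assms
proof (induction "card B" arbitrary: K B rule: less_induct)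
  case less
  note K = less.prems(1) and BK = less.prems(2) and B0 = less.prems(3) and up = less.prems(4)
    and wY = less.prems(5) and ins = less.prems(6) and del = less.prems(7)
  have finB: "finite B" and finK: "finite K"
    using K BK by (auto simp: finite_complex_def intro: finite_subset)
  show ?case
  proof (cases "B = {}")
    case True
    then show ?thesis
      by (simp add: homotopy_equivalent_space_refl)
  next
    case False
    have "finite ((\<lambda>\<rho>. \<rho> - Y) ` B)" "(\<lambda>\<rho>. \<rho> - Y) ` B \<noteq> {}"
      using finB False by auto
    \<comment> \<open>Maximality of \<open>\<mu>\<close> gives all supersets of
      \<open>\<tau>\<close> in \<open>K\<close> the same trace outside \<open>Y\<close>, hence the
      same toggled vertex \<open>?w\<close>. Minimality of \<open>\<tau>\<close> within the fibre
      \<open>M\<close> keeps \<open>?w\<close> out of \<open>\<tau>\<close>. So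
      \<open>\<tau>\<close> can be collapsed with apex \<open>?w\<close>.\<close>
    then obtain \<mu> where \<mu>: "\<mu> \<in> (\<lambda>\<rho>. \<rho> - Y) ` B"
      and max: "\<And>\<rho>. \<rho> \<in> B \<Longrightarrow> \<mu> \<subseteq> \<rho> - Y \<Longrightarrow> \<rho> - Y = \<mu>"
      using finite_has_maximal[of "(\<lambda>\<rho>. \<rho> - Y) ` B"] by blast
    define M where "M = {\<rho> \<in> B. \<rho> - Y = \<mu>}"
    have "finite M" "M \<noteq> {}"
      using \<mu> finB by (auto simp: M_def)
    then obtain \<tau> where "\<tau> \<in> M" and min: "\<And>\<rho>. \<rho> \<in> M \<Longrightarrow> \<rho> \<subseteq> \<tau> \<Longrightarrow> \<rho> = \<tau>"
      using finite_has_minimal[of M] by blast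
    then have \<tau>: "\<tau> \<in> B" "\<tau> - Y = \<mu>"
      by (auto simp: M_def)
    let ?w = "w \<mu>"
    have w\<mu>Y: "?w \<in> Y"
      using wY \<tau> by blast
    have w\<tau>: "?w \<notin> \<tau>"
    proof
      assume "?w \<in> \<tau>"
      moreover have "\<tau> - {?w} \<in> M"
        using del[OF \<tau>(1)] \<tau> w\<mu>Y by (auto simp: M_def)
      ultimately show False
        using min by blast
    qed
    have above: "\<sigma> \<in> B \<and> \<sigma> - Y = \<mu>" if "\<sigma> \<in> K" "\<tau> \<subseteq> \<sigma>" for \<sigma>
      using up[OF \<tau>(1) that] max that \<tau> by blast
    let ?K = "{\<sigma> \<in> K. \<not> \<tau> \<subseteq> \<sigma>}" and ?B = "{\<sigma> \<in> B. \<not> \<tau> \<subseteq> \<sigma>}"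
    have "geometric_realization K homotopy_equivalent_space geometric_realization ?K"
    proof (rule homotopy_equivalent_dominated_collapse[OF K _ _ w\<tau>])
      show "\<tau> \<noteq> {}" "finite \<tau>"
        using \<tau> B0 BK K by (auto simp: finite_complex_def)
      show "insert ?w \<sigma> \<in> K" if "\<sigma> \<in> K" "\<tau> \<subseteq> \<sigma>" for \<sigma>
        using ins[of \<sigma>] above[OF that] by simp
    qed
    also have "geometric_realization ?K homotopy_equivalent_space geometric_realization (?K - ?B)"
    proof (rule less.hyps)
      show "card ?B < card B"
        using \<tau> finB by (intro psubset_card_mono) auto
      show "finite_complex ?K"
        using K by (auto simp: finite_complex_def)
      show "insert (w (\<rho> - Y)) \<rho> \<in> ?K" if "\<rho> \<in> ?B" for \<rho>
      proof -
        have \<rho>: "\<rho> \<in> B" "\<not> \<tau> \<subseteq> \<rho>"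
          using that by auto
        \<comment> \<open>Insertion does not lead out of the smaller complex: if it completed
          \<open>\<tau>\<close>, the trace of \<open>\<rho>\<close> would be \<open>\<mu>\<close>,
          the inserted vertex would be \<open>?w\<close>, which is not in \<open>\<tau>\<close>, and
          \<open>\<rho>\<close> would contain \<open>\<tau>\<close> already.\<close>
        have "\<not> \<tau> \<subseteq> insert (w (\<rho> - Y)) \<rho>"
        proof
          assume sub: "\<tau> \<subseteq> insert (w (\<rho> - Y)) \<rho>"
          have "insert (w (\<rho> - Y)) \<rho> - Y = \<mu>"
            using above[OF ins[OF \<rho>(1)] sub] by simp
          then have "\<rho> - Y = \<mu>"
            using wY[OF \<rho>(1)] by blast
          then show False
            using sub \<rho> w\<tau> by auto
        qed
        then show ?thesis
          using ins \<rho> by simp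
      qed
      show "\<rho> - {w (\<rho> - Y)} \<in> ?B" if "\<rho> \<in> ?B" for \<rho>
        using del[of \<rho>] that by auto
    qed (use BK B0 up wY in auto)
    also have "?K - ?B = K - B"
      using up \<tau> by blast
    finally show ?thesis .
  qed
qed

text \<open>Transporting barycentric coordinates along \<open>\<phi>\<close> and back gives mutually
  inverse continuous maps. Coordinates off \<open>W\<close> and off \<open>V\<close> are set to 0,
  which is their value on the realizations, so the inverse laws hold on the whole vertex
  type.\<close>

lemma homotopy_equivalent_relabel:
  assumes bij: "bij_betw \<phi> V W" and finV: "finite V" and KV: "K \<subseteq> Pow V" and LW: "L \<subseteq> Pow W"
    and iff: "\<And>\<sigma>. \<sigma> \<subseteq> V \<Longrightarrow> \<sigma> \<in> K \<longleftrightarrow> \<phi> ` \<sigma> \<in> L"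
  shows "geometric_realization K homotopy_equivalent_space geometric_realization L"
proof -
  let ?F = "\<lambda>x v. if v \<in> W then x (inv_into V \<phi> v) else (0 :: real)"
  let ?G = "\<lambda>x v. if v \<in> V then x (\<phi> v) else (0 :: real)"
  have inj: "inj_on \<phi> V" and im: "\<phi> ` V = W"
    using bij by (auto simp: bij_betw_def)
  have inv1: "inv_into V \<phi> (\<phi> v) = v" if "v \<in> V" for v
    using that inj by simp
  have inv2: "\<phi> (inv_into V \<phi> w) = w" "inv_into V \<phi> w \<in> V" if "w \<in> W" for w
    using that im by (auto simp: f_inv_into_f inv_into_into)
  have finW: "finite W"
    using finV im by blast
  have contF: "continuous_on S ?F" for S
  proof (rule continuous_on_coordinatewise_then_product)
    show "continuous_on S (\<lambda>x. ?F x v)" for v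
      by (cases "v \<in> W") (auto intro: continuous_on_subset[OF continuous_on_product_coordinates])
  qed
  have contG: "continuous_on S ?G" for S
  proof (rule continuous_on_coordinatewise_then_product)
    show "continuous_on S (\<lambda>x. ?G x v)" for v
      by (cases "v \<in> V") (auto intro: continuous_on_subset[OF continuous_on_product_coordinates])
  qed
  have F: "?F x \<in> closed_simplex (\<phi> ` \<sigma>)" if "\<sigma> \<subseteq> V" "x \<in> closed_simplex \<sigma>" for x \<sigma>
  proof -
    have "(\<Sum>w\<in>\<phi> ` \<sigma>. ?F x w) = (\<Sum>v\<in>\<sigma>. ?F x (\<phi> v))"
      using inj_on_subset[OF inj that(1)] by (rule sum.reindex_cong) auto
    also have "\<dots> = (\<Sum>v\<in>\<sigma>. x v)"
    proof (rule sum.cong)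
      fix v assume "v \<in> \<sigma>"
      then have "v \<in> V" "\<phi> v \<in> W"
        using that im by auto
      then show "?F x (\<phi> v) = x v"
        using inv1 by simp
    qed simp
    finally show ?thesis
      using that inv2 by (force simp: closed_simplex_def)
  qed
  have G: "?G y \<in> closed_simplex \<sigma>" if "\<sigma> \<subseteq> V" "y \<in> closed_simplex (\<phi> ` \<sigma>)" for y \<sigma>
  proof -
    have "(\<Sum>w\<in>\<phi> ` \<sigma>. y w) = (\<Sum>v\<in>\<sigma>. y (\<phi> v))"
      using inj_on_subset[OF inj that(1)] by (rule sum.reindex_cong) auto
    also have "\<dots> = (\<Sum>v\<in>\<sigma>. ?G y v)"
      using that by (intro sum.cong) auto
    finally have "(\<Sum>v\<in>\<sigma>. ?G y v) = 1"
      using that by (simp add: closed_simplex_def)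
    moreover have "\<phi> v \<notin> \<phi> ` \<sigma>" if "v \<in> V" "v \<notin> \<sigma>" for v
      using that \<open>\<sigma> \<subseteq> V\<close> inj by (auto dest: inj_onD)
    ultimately show ?thesis
      using that by (auto simp: closed_simplex_def)
  qed
  have preimage: "\<exists>\<sigma>\<in>K. \<tau> = \<phi> ` \<sigma>" if "\<tau> \<in> L" for \<tau>
  proof -
    obtain \<sigma> where "\<sigma> \<subseteq> V" "\<tau> = \<phi> ` \<sigma>"
      using \<open>\<tau> \<in> L\<close> LW im by (metis Pow_iff subset_eq subset_image_iff)
    then show ?thesis
      using iff \<open>\<tau> \<in> L\<close> by blast
  qed
  let ?S = "\<Union>\<sigma>\<in>K. closed_simplex \<sigma>" and ?T = "\<Union>\<sigma>\<in>L. closed_simplex \<sigma>"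
  have "homeomorphic_maps (top_of_set ?S) (top_of_set ?T) ?F ?G"
    unfolding homeomorphic_maps_def
  proof (intro conjI ballI)
    have "?F x \<in> ?T" if "x \<in> ?S" for x
    proof -
      obtain \<sigma> where "\<sigma> \<in> K" "x \<in> closed_simplex \<sigma>"
        using \<open>x \<in> ?S\<close> by blast
      then have "\<phi> ` \<sigma> \<in> L" "?F x \<in> closed_simplex (\<phi> ` \<sigma>)"
        using KV iff by (auto intro!: F)
      then show ?thesis
        by (rule UN_I)
    qed
    then show "continuous_map (top_of_set ?S) (top_of_set ?T) ?F"
      using contF by (simp add: image_subset_iff)
    have "?G y \<in> ?S" if "y \<in> ?T" for y
    proof -
      obtain \<tau> where "\<tau> \<in> L" "y \<in> closed_simplex \<tau>"
        using \<open>y \<in> ?T\<close> by blast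
      then obtain \<sigma> where "\<sigma> \<in> K" "y \<in> closed_simplex (\<phi> ` \<sigma>)"
        using preimage by blast
      then have "?G y \<in> closed_simplex \<sigma>"
        using KV by (intro G) auto
      then show ?thesis
        by (rule UN_I[OF \<open>\<sigma> \<in> K\<close>])
    qed
    then show "continuous_map (top_of_set ?T) (top_of_set ?S) ?G"
      using contG by (simp add: image_subset_iff)
    show "?G (?F x) = x" if "x \<in> topspace (top_of_set ?S)" for x
    proof
      fix v
      have "x v = 0" if "v \<notin> V"
        using that \<open>x \<in> topspace (top_of_set ?S)\<close> KV by (auto simp: closed_simplex_def)
      then show "?G (?F x) v = x v"
        using inv1 im by auto
    qed
    show "?F (?G y) = y" if "y \<in> topspace (top_of_set ?T)" for y
    proof
      fix w
      have "y w = 0" if "w \<notin> W"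
        using that \<open>y \<in> topspace (top_of_set ?T)\<close> LW by (auto simp: closed_simplex_def)
      then show "?F (?G y) w = y w"
        using inv2 by auto
    qed
  qed
  moreover have "finite K" "finite L"
    using KV LW finV finW by (auto intro: finite_subset)
  ultimately show ?thesis
    by (intro homeomorphic_imp_homotopy_equivalent_space)
      (auto simp: geometric_realization_eq_top_of_set homeomorphic_space_def)
qed

section \<open>Independence complexes\<close>

definition indep_complex :: "'a set \<Rightarrow> ('a \<Rightarrow> 'a \<Rightarrow> bool) \<Rightarrow> 'a set set" where
  "indep_complex V E = {\<sigma>. finite \<sigma> \<and> \<sigma> \<subseteq> V \<and> (\<forall>a\<in>\<sigma>. \<forall>b\<in>\<sigma>. \<not> E a b)}"

lemma finite_complex_indep_complex:
  assumes "finite V"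
  shows "finite_complex (indep_complex V E)"
proof -
  have "indep_complex V E \<subseteq> Pow V"
    by (auto simp: indep_complex_def)
  then have "finite (indep_complex V E)"
    using assms by (auto intro: finite_subset)
  moreover have "\<tau> \<in> indep_complex V E" if "\<sigma> \<in> indep_complex V E" "\<tau> \<subseteq> \<sigma>" for \<sigma> \<tau>
    using that unfolding indep_complex_def by (blast intro: finite_subset)
  moreover have "finite \<sigma>" if "\<sigma> \<in> indep_complex V E" for \<sigma>
    using that by (simp add: indep_complex_def)
  ultimately show ?thesis
    unfolding finite_complex_def by blast
qed

lemma indep_complex_relabel:
  assumes bij: "bij_betw \<phi> V W" and "finite V"
    and E: "\<And>a b. a \<in> V \<Longrightarrow> b \<in> V \<Longrightarrow> E a b \<longleftrightarrow> E' (\<phi> a) (\<phi> b)"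
  shows "geometric_realization (indep_complex V E) homotopy_equivalent_space
    geometric_realization (indep_complex W E')"
proof (rule homotopy_equivalent_relabel[OF bij \<open>finite V\<close>])
  have "\<phi> ` V = W"
    using bij by (simp add: bij_betw_def)
  show "\<sigma> \<in> indep_complex V E \<longleftrightarrow> \<phi> ` \<sigma> \<in> indep_complex W E'" if "\<sigma> \<subseteq> V" for \<sigma>
  proof -
    have "(\<forall>a\<in>\<sigma>. \<forall>b\<in>\<sigma>. \<not> E a b) \<longleftrightarrow> (\<forall>a\<in>\<phi> ` \<sigma>. \<forall>b\<in>\<phi> ` \<sigma>. \<not> E' a b)"
      using that E by blast
    then show ?thesis
      using finite_subset[OF that \<open>finite V\<close>] image_mono[OF that, of \<phi>] that \<open>\<phi> ` V = W\<close>
      by (simp add: indep_complex_def)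
  qed
qed (auto simp: indep_complex_def)

text \<open>An isolated vertex \<open>w\<close> can be added to every simplex, so the complex is a
  cone with apex \<open>w\<close>; toggling \<open>w\<close> matches all simplices except
  \<open>{}\<close> and \<open>{w}\<close>.\<close>

lemma indep_complex_cone:
  assumes "finite V" and "w \<in> V" and "\<And>a. a \<in> V \<Longrightarrow> \<not> E a w \<and> \<not> E w a"
  shows "geometric_realization (indep_complex V E) homotopy_equivalent_space
    geometric_realization (indep_complex {w} E)"
proof -
  let ?K = "indep_complex V E"
  let ?B = "{\<sigma> \<in> ?K. \<not> \<sigma> \<subseteq> {w}}"
  have "geometric_realization ?K homotopy_equivalent_space geometric_realization (?K - ?B)"
  proof (rule homotopy_equivalent_matching_collapse[where w = "\<lambda>_. w" and Y = "{w}"])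
    show "finite_complex ?K"
      using assms by (simp add: finite_complex_indep_complex)
    show "insert w \<rho> \<in> ?K" if "\<rho> \<in> ?B" for \<rho>
      using that assms by (auto simp: indep_complex_def subset_iff)
  qed (auto simp: indep_complex_def)
  also have "?K - ?B = indep_complex {w} E"
    using assms by (auto simp: indep_complex_def)
  finally show ?thesis .
qed

text \<open>
  Discarding the simplices that block all of \<open>N\<close> (matched by \<open>v\<close>) leaves simplices
  \<open>\<sigma> \<union> \<tau>\<close> with \<open>\<tau> \<subseteq> N\<close> not meeting the neighbours of \<open>\<sigma>\<close>. As every such \<open>\<sigma>\<close>
  still leaves some vertex of \<open>N\<close> free, the restriction on \<open>\<tau>\<close> can be dropped by expansions
  towards a free vertex; the full simplex on \<open>N\<close> then collapses to \<open>y\<close>.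
\<close>

lemma indep_complex_unfold_star:
  assumes finV: "finite V" and sym: "\<And>a b. E a b \<Longrightarrow> E b a" and v: "v \<in> V" "\<not> E v v"
    and N: "N = {b \<in> V. E v b}" and indep: "\<And>a b. a \<in> N \<Longrightarrow> b \<in> N \<Longrightarrow> \<not> E a b" and y: "y \<in> N"
    and W: "W = V - N - {v}"
  shows "geometric_realization (indep_complex V E) homotopy_equivalent_space
    geometric_realization {\<rho>. \<rho> \<subseteq> insert v (insert y W) \<and> \<not> (v \<in> \<rho> \<and> y \<in> \<rho>) \<and>
      \<rho> \<inter> W \<in> indep_complex W E \<and> (\<exists>b\<in>N. \<forall>a\<in>\<rho> \<inter> W. \<not> E a b)}"
proof -
  let ?K0 = "indep_complex V E"
  \<comment> \<open>The vertex \<open>v\<close> is adjacent to all of \<open>N\<close>, so it is not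
    counted as a blocker; toggling it then does not affect membership.\<close>
  let ?B1 = "{\<rho> \<in> ?K0. \<forall>b\<in>N. \<exists>a\<in>\<rho> - {v}. E a b}"
  \<comment> \<open>This is the join of the complex of those \<open>\<sigma> \<subseteq> W\<close>
    that leave a vertex of \<open>N\<close> free with the disjoint union of the point
    \<open>v\<close> and the full simplex on \<open>N\<close>. Edges between \<open>W\<close> and
    \<open>N\<close> are ignored here; \<open>?B2\<close> consists of the simplices that contain
    such an edge.\<close>
  let ?K2 = "{\<rho>. \<rho> \<subseteq> V \<and> \<not> (v \<in> \<rho> \<and> \<rho> \<inter> N \<noteq> {}) \<and>
      \<rho> \<inter> W \<in> indep_complex W E \<and> (\<exists>b\<in>N. \<forall>a\<in>\<rho> \<inter> W. \<not> E a b)}"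
  let ?B2 = "{\<rho> \<in> ?K2. \<exists>b\<in>\<rho> \<inter> N. \<exists>a\<in>\<rho> \<inter> W. E a b}"
  let ?B3 = "{\<rho> \<in> ?K2. \<rho> \<inter> (N - {y}) \<noteq> {}}"
  have NV: "N \<subseteq> V" and vN: "v \<notin> N" and V: "V = insert v (N \<union> W)" and WN: "W \<inter> N = {}" and vW: "v \<notin> W"
    using v N W by auto
  have Ev: "E v b \<longleftrightarrow> b \<in> N" "E b v \<longleftrightarrow> b \<in> N" if "b \<in> V" for b
    using N that sym by auto
  have K0: "finite_complex ?K0"
    using finV by (rule finite_complex_indep_complex)
  have indepW: "\<tau> \<in> indep_complex W E" if "\<sigma> \<in> indep_complex W E" "\<tau> \<subseteq> \<sigma>" for \<sigma> \<tau>
    using that unfolding indep_complex_def by (blast intro: finite_subset)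
  have K2: "finite_complex ?K2"
    unfolding finite_complex_def
  proof (intro conjI ballI allI impI)
    show "finite ?K2"
      by (rule finite_subset[of _ "Pow V"]) (use finV in auto)
    show "\<tau> \<in> ?K2" if "\<sigma> \<in> ?K2" "\<tau> \<subseteq> \<sigma>" for \<sigma> \<tau>
      using that indepW[of "\<sigma> \<inter> W" "\<tau> \<inter> W"] by blast
  qed (use finV finite_subset in auto)
  have K2I: "\<rho> \<in> ?K2" if "\<sigma> \<in> ?K2" "\<rho> \<subseteq> V" "\<rho> \<inter> W = \<sigma> \<inter> W" "v \<notin> \<rho>" for \<rho> \<sigma>
    using that by simp
  have "geometric_realization ?K0 homotopy_equivalent_space geometric_realization (?K0 - ?B1)"
  proof (rule homotopy_equivalent_matching_collapse[OF K0, where w = "\<lambda>_. v" and Y = "{v}"])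
    show "insert v \<rho> \<in> ?K0" if \<rho>: "\<rho> \<in> ?B1" for \<rho>
    proof -
      have \<rho>K: "finite \<rho>" "\<rho> \<subseteq> V" "\<And>a b. a \<in> \<rho> \<Longrightarrow> b \<in> \<rho> \<Longrightarrow> \<not> E a b"
        and blocked: "\<And>b. b \<in> N \<Longrightarrow> \<exists>a\<in>\<rho>. E a b"
        using \<rho> by (auto simp: indep_complex_def)
      \<comment> \<open>A vertex of \<open>N\<close> in \<open>\<rho>\<close> would be blocked by a
        neighbour in \<open>\<rho>\<close>, against independence. So nothing in
        \<open>\<rho>\<close> is adjacent to \<open>v\<close>.\<close>
      have "\<rho> \<inter> N = {}"
        using \<rho>K(3) blocked by blast
      then have "\<not> E v a \<and> \<not> E a v" if "a \<in> \<rho>" for a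
        using Ev \<rho>K(2) that by blast
      then show ?thesis
        using \<rho>K v by (auto simp: indep_complex_def)
    qed
    show "\<rho> - {v} \<in> ?B1" if "\<rho> \<in> ?B1" for \<rho>
      using that by (auto simp: indep_complex_def)
    show "\<sigma> \<in> ?B1" if "\<rho> \<in> ?B1" "\<sigma> \<in> ?K0" "\<rho> \<subseteq> \<sigma>" for \<rho> \<sigma>
      using that by blast
  qed (use y in auto)
  also have "?K0 - ?B1 = ?K2 - ?B2"
  proof (intro equalityI subsetI)
    fix \<rho> assume \<rho>: "\<rho> \<in> ?K0 - ?B1"
    then have "\<rho> \<inter> W \<in> indep_complex W E" "\<rho> \<subseteq> V"
      by (auto simp: indep_complex_def)
    moreover have "\<exists>b\<in>N. \<forall>a\<in>\<rho> \<inter> W. \<not> E a b"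
      using \<rho> vW by auto
    moreover have "\<not> (v \<in> \<rho> \<and> \<rho> \<inter> N \<noteq> {})"
      using \<rho> N by (auto simp: indep_complex_def)
    moreover have "\<not> (\<exists>b\<in>\<rho> \<inter> N. \<exists>a\<in>\<rho> \<inter> W. E a b)"
      using \<rho> by (auto simp: indep_complex_def)
    ultimately show "\<rho> \<in> ?K2 - ?B2"
      by simp
  next
    fix \<rho> assume \<rho>: "\<rho> \<in> ?K2 - ?B2"
    then have \<rho>V: "\<rho> \<subseteq> V" and vs: "\<not> (v \<in> \<rho> \<and> \<rho> \<inter> N \<noteq> {})"
      and ind: "\<rho> \<inter> W \<in> indep_complex W E" and free: "\<exists>b\<in>N. \<forall>a\<in>\<rho> \<inter> W. \<not> E a b"
      by simp_all
    have mixed: "\<not> (\<exists>b\<in>\<rho> \<inter> N. \<exists>a\<in>\<rho> \<inter> W. E a b)"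
      using \<rho> by blast
    have indW: "\<not> E a b" if "a \<in> \<rho> \<inter> W" "b \<in> \<rho> \<inter> W" for a b
      using ind that by (simp add: indep_complex_def)
    have "\<not> E a b" if "a \<in> \<rho>" "b \<in> \<rho>" for a b
    proof (cases "a = v \<or> b = v")
      case True
      then show ?thesis
        using that vs v(2) Ev[of a] Ev[of b] \<rho>V by blast
    next
      case False
      then have "a \<in> N \<union> W" "b \<in> N \<union> W"
        using that \<rho>V V by auto
      then show ?thesis
        using that indW mixed indep sym by blast
    qed
    moreover have "finite \<rho>"
      using \<rho>V finV finite_subset by blast
    ultimately have "\<rho> \<in> ?K0"
      using \<rho>V by (auto simp: indep_complex_def)
    moreover obtain b where b: "b \<in> N" "\<And>a. a \<in> \<rho> \<inter> W \<Longrightarrow> \<not> E a b"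
      using free by blast
    \<comment> \<open>Vertices of \<open>N\<close> do not block each other, so freeness of
      \<open>b\<close> from the part in \<open>W\<close> is enough.\<close>
    have "\<not> E a b" if "a \<in> \<rho> - {v}" for a
      using that b indep \<rho>V V by blast
    ultimately show "\<rho> \<in> ?K0 - ?B1"
      using b(1) by blast
  qed
  also have "geometric_realization (?K2 - ?B2) homotopy_equivalent_space geometric_realization ?K2"
  proof -
    \<comment> \<open>The free vertex is chosen from the part of \<open>\<rho>\<close> in
      \<open>W\<close> alone, so toggling vertices of \<open>N\<close> leaves the choice unchanged.
      The resulting collapse is then read backwards, as an expansion to \<open>?K2\<close>.\<close>
    define w where "w \<sigma> = (SOME b. b \<in> N \<and> (\<forall>a\<in>\<sigma>. \<not> E a b))" for \<sigma>
    have w: "w (\<rho> - N) \<in> N" "\<forall>a\<in>\<rho> \<inter> W. \<not> E a (w (\<rho> - N))" if "\<rho> \<in> ?B2" for \<rho>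
    proof -
      have "v \<notin> \<rho>" "\<rho> \<subseteq> V" "\<exists>b\<in>N. \<forall>a\<in>\<rho> \<inter> W. \<not> E a b"
        using that by blast+
      then have "\<rho> - N = \<rho> \<inter> W" "\<exists>b. b \<in> N \<and> (\<forall>a\<in>\<rho> \<inter> W. \<not> E a b)"
        using V WN by blast+
      then show "w (\<rho> - N) \<in> N" "\<forall>a\<in>\<rho> \<inter> W. \<not> E a (w (\<rho> - N))"
        using someI_ex[of "\<lambda>b. b \<in> N \<and> (\<forall>a\<in>\<rho> \<inter> W. \<not> E a b)"] by (simp_all add: w_def)
    qed
    have toggle: "insert c \<rho> \<in> ?K2" "\<rho> - {c} \<in> ?B2"
      if \<rho>: "\<rho> \<in> ?B2" and c: "c \<in> N" "\<forall>a\<in>\<rho> \<inter> W. \<not> E a c" for \<rho> c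
    proof -
      obtain a b where ab: "a \<in> \<rho> \<inter> W" "b \<in> \<rho> \<inter> N" "E a b"
        using \<rho> by blast
      have \<rho>K: "\<rho> \<in> ?K2" "\<rho> \<subseteq> V"
        using \<rho> by simp_all
      have "v \<notin> \<rho>"
        using \<rho> ab(2) by blast
      have eq: "insert c \<rho> \<inter> W = \<rho> \<inter> W" "(\<rho> - {c}) \<inter> W = \<rho> \<inter> W"
        using c(1) WN by blast+
      show "insert c \<rho> \<in> ?K2"
        by (rule K2I[OF \<rho>K(1) _ eq(1)]) (use c(1) NV \<rho>K(2) \<open>v \<notin> \<rho>\<close> vN in auto)
      have del: "\<rho> - {c} \<in> ?K2"
        by (rule K2I[OF \<rho>K(1) _ eq(2)]) (use \<rho>K(2) \<open>v \<notin> \<rho>\<close> in auto)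
      \<comment> \<open>The vertex \<open>b\<close> of the offending edge differs from the free
        vertex \<open>c\<close>, so the edge survives the deletion of \<open>c\<close>.\<close>
      have ex: "\<exists>b\<in>(\<rho> - {c}) \<inter> N. \<exists>a\<in>(\<rho> - {c}) \<inter> W. E a b"
        unfolding eq(2) using ab c(2) by blast
      show "\<rho> - {c} \<in> ?B2"
        by (rule CollectI, rule conjI, rule del, rule ex)
    qed
    have "geometric_realization ?K2 homotopy_equivalent_space geometric_realization (?K2 - ?B2)"
    proof (rule homotopy_equivalent_matching_collapse[OF K2, where Y = N and w = w])
      show "\<sigma> \<in> ?B2" if "\<rho> \<in> ?B2" "\<sigma> \<in> ?K2" "\<rho> \<subseteq> \<sigma>" for \<rho> \<sigma>
        using that by blast
      show "w (\<rho> - N) \<in> N" if "\<rho> \<in> ?B2" for \<rho>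
        by (rule w(1)[OF that])
      show "insert (w (\<rho> - N)) \<rho> \<in> ?K2" "\<rho> - {w (\<rho> - N)} \<in> ?B2" if "\<rho> \<in> ?B2" for \<rho>
        by (rule toggle[OF that w[OF that]])+
    qed auto
    then show ?thesis
      by (rule homotopy_equivalent_space_sym[THEN iffD1])
  qed
  \<comment> \<open>The vertices of \<open>N\<close> other than \<open>y\<close> disappear, leaving
    \<open>v\<close> and \<open>y\<close> as the poles of a suspension over the complex on
    \<open>W\<close>.\<close>
  also have "geometric_realization ?K2 homotopy_equivalent_space geometric_realization (?K2 - ?B3)"
  proof (rule homotopy_equivalent_matching_collapse[OF K2, where Y = "{y}" and w = "\<lambda>_. y"])
    fix \<rho> assume \<rho>: "\<rho> \<in> ?B3"
    have "insert y \<rho> \<inter> W = \<rho> \<inter> W" "(\<rho> - {y}) \<inter> W = \<rho> \<inter> W"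
      using y WN by blast+
    moreover have "v \<notin> insert y \<rho>" "\<rho> \<subseteq> V" "\<rho> \<in> ?K2"
      using \<rho> y vN by blast+
    ultimately have "insert y \<rho> \<in> ?K2" "\<rho> - {y} \<in> ?K2"
      using y NV by (auto intro!: K2I[of \<rho>])
    then show "insert y \<rho> \<in> ?K2" "\<rho> - {y} \<in> ?B3"
      using \<rho> by auto
  next
    show "\<sigma> \<in> ?B3" if "\<rho> \<in> ?B3" "\<sigma> \<in> ?K2" "\<rho> \<subseteq> \<sigma>" for \<rho> \<sigma>
      using that by blast
  qed blast+
  also have "?K2 - ?B3 = {\<rho>. \<rho> \<subseteq> insert v (insert y W) \<and> \<not> (v \<in> \<rho> \<and> y \<in> \<rho>) \<and>
      \<rho> \<inter> W \<in> indep_complex W E \<and> (\<exists>b\<in>N. \<forall>a\<in>\<rho> \<inter> W. \<not> E a b)}"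
    using V WN vN y by auto
  finally show ?thesis .
qed

text \<open>
  The gap hypothesis turns the condition that \<open>\<sigma>\<close> leaves some vertex of \<open>N\<close> free into
  the pairwise intersection of the intervals \<open>{f a..g a}\<close> (Helly's theorem on the line).
\<close>

lemma indep_complex_unfold_star_interval:
  fixes f g :: "'a \<Rightarrow> 'a :: linorder"
  assumes finV: "finite V" and sym: "\<And>a b. E a b \<Longrightarrow> E b a" and v: "v \<in> V" "\<not> E v v"
    and N: "N = {b \<in> V. E v b}" and indep: "\<And>a b. a \<in> N \<Longrightarrow> b \<in> N \<Longrightarrow> \<not> E a b" and y: "y \<in> N"
    and W: "W = V - N - {v}"
    and gap: "\<And>a b. a \<in> W \<Longrightarrow> b \<in> N \<Longrightarrow> \<not> E a b \<longleftrightarrow> f a \<le> b \<and> b \<le> g a"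
    and fN: "\<And>a. a \<in> W \<Longrightarrow> f a \<in> N"
    and E': "\<And>a b. a \<in> W \<Longrightarrow> b \<in> W \<Longrightarrow> E' a b \<longleftrightarrow> E a b \<or> g a < f b \<or> g b < f a"
    and E'v: "\<And>a. a \<in> W \<Longrightarrow> \<not> E' a v \<and> \<not> E' v a \<and> \<not> E' a y \<and> \<not> E' y a"
      "E' v y" "\<not> E' v v" "\<not> E' y y"
  shows "geometric_realization (indep_complex V E) homotopy_equivalent_space
    geometric_realization (indep_complex (insert v (insert y W)) E')"
proof -
  have finW: "finite W"
    using W finV by simp
  \<comment> \<open>The case \<open>a = b\<close> matters: it says that the interval of
    \<open>a\<close> is nonempty.\<close>
  have helly: "(\<exists>b\<in>N. \<forall>a\<in>\<sigma>. \<not> E a b) \<longleftrightarrow> (\<forall>a\<in>\<sigma>. \<forall>b\<in>\<sigma>. f a \<le> g b)" if \<sigma>: "\<sigma> \<subseteq> W" for \<sigma>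
  proof
    assume "\<exists>b\<in>N. \<forall>a\<in>\<sigma>. \<not> E a b"
    then obtain c where "c \<in> N" "\<And>a. a \<in> \<sigma> \<Longrightarrow> \<not> E a c"
      by blast
    then have "f a \<le> c \<and> c \<le> g a" if "a \<in> \<sigma>" for a
      using gap that \<sigma> by blast
    then show "\<forall>a\<in>\<sigma>. \<forall>b\<in>\<sigma>. f a \<le> g b"
      by (meson order_trans)
  next
    assume le: "\<forall>a\<in>\<sigma>. \<forall>b\<in>\<sigma>. f a \<le> g b"
    show "\<exists>b\<in>N. \<forall>a\<in>\<sigma>. \<not> E a b"
    proof (cases "\<sigma> = {}")
      case True
      then show ?thesis
        using y by blast
    next
      case False
      have "finite \<sigma>"
        using \<sigma> finW finite_subset by blast
      then have "Max (f ` \<sigma>) \<in> f ` \<sigma>" and "\<And>a. a \<in> \<sigma> \<Longrightarrow> f a \<le> Max (f ` \<sigma>)"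
        using False by auto
      \<comment> \<open>The largest left end \<open>f c\<close> is the common point: it belongs to
        \<open>N\<close>, and pairwise intersection puts it below every right end.\<close>
      then obtain c where c: "c \<in> \<sigma>" and max: "\<And>a. a \<in> \<sigma> \<Longrightarrow> f a \<le> f c"
        by force
      have "\<not> E a (f c)" if "a \<in> \<sigma>" for a
        using gap[of a "f c"] fN[of c] max[OF that] le c that \<sigma> by blast
      then show ?thesis
        using fN c \<sigma> by blast
    qed
  qed
  have vyW: "v \<notin> W" "y \<notin> W"
    using W y by auto
  have "{\<rho>. \<rho> \<subseteq> insert v (insert y W) \<and> \<not> (v \<in> \<rho> \<and> y \<in> \<rho>) \<and>
      \<rho> \<inter> W \<in> indep_complex W E \<and> (\<exists>b\<in>N. \<forall>a\<in>\<rho> \<inter> W. \<not> E a b)} =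
    indep_complex (insert v (insert y W)) E'" (is "?L = ?R")
  proof (intro equalityI subsetI)
    fix \<rho> assume \<rho>: "\<rho> \<in> ?L"
    then have sub: "\<rho> \<subseteq> insert v (insert y W)" and vy: "\<not> (v \<in> \<rho> \<and> y \<in> \<rho>)"
      and ind: "\<And>a b. a \<in> \<rho> \<inter> W \<Longrightarrow> b \<in> \<rho> \<inter> W \<Longrightarrow> \<not> E a b"
      and le: "\<And>a b. a \<in> \<rho> \<inter> W \<Longrightarrow> b \<in> \<rho> \<inter> W \<Longrightarrow> f a \<le> g b"
      using helly[of "\<rho> \<inter> W"] by (auto simp: indep_complex_def)
    have "\<not> E' a b" if "a \<in> \<rho>" "b \<in> \<rho>" for a b
    proof (cases "a \<in> W \<and> b \<in> W")
      case True
      then show ?thesis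
        using E' that ind[of a b] le[of a b] le[of b a] by (auto simp: not_less)
    next
      case False
      then show ?thesis
        using that sub vy E'v by blast
    qed
    moreover have "finite \<rho>"
      using sub finW finite_subset by blast
    ultimately show "\<rho> \<in> ?R"
      using sub by (auto simp: indep_complex_def)
  next
    fix \<rho> assume \<rho>: "\<rho> \<in> ?R"
    then have "f a \<le> g b \<and> \<not> E a b" if "a \<in> \<rho> \<inter> W" "b \<in> \<rho> \<inter> W" for a b
      using that E'[of a b] by (auto simp: indep_complex_def not_less)
    then show "\<rho> \<in> ?L"
      using \<rho> E'v(2) helly[of "\<rho> \<inter> W"] by (auto simp: indep_complex_def)
  qed
  moreover have "geometric_realization (indep_complex V E) homotopy_equivalent_space geometric_realization ?L"
    by (rule indep_complex_unfold_star[of V E v N y W]) (fact finV sym v N indep y W)+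
  ultimately show ?thesis
    by simp
qed

section \<open>Powers of cycles\<close>

text \<open>Each arc changes the residue by 1 or -1; \<open>j\<close> is the sum of these signs.
  This yields the lower bound on distances.\<close>

lemma cycle_graph_walk_displacement:
  assumes "pre_digraph.awalk (with_proj (cycle_graph m)) u p v"
  shows "\<exists>j :: int. \<bar>j\<bar> \<le> int (length p) \<and> int m dvd int v - int u - j"
proof -
  interpret pair_graph "cycle_graph m"
    by (rule pair_graph_cycle_graph)
  show ?thesis
    using assms
  proof (induction p arbitrary: u)
    case Nil
    then show ?case
      by (auto simp: awalk_Nil_iff)
  next
    case (Cons e p)
    then obtain w where e: "(u, w) \<in> parcs (cycle_graph m)" and walk: "awalk w p v"
      by (cases e) (auto simp: awalk_Cons_iff)
    from Cons.IH[OF walk] obtain j where j: "\<bar>j\<bar> \<le> int (length p)" "int m dvd int v - int w - j"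
      by blast
    have "w = (u + 1) mod m \<or> u = (w + 1) mod m"
      using e by (auto simp: cycle_graph_def)
    then have "int m dvd int w - int u - 1 \<or> int m dvd int w - int u - (- 1)"
    proof
      assume "w = (u + 1) mod m"
      then have "int w = (int u + 1) mod int m"
        by (simp add: zmod_int ac_simps)
      then have "int m dvd int w - (int u + 1)"
        using mod_eq_dvd_iff[of "int w" "int m" "int u + 1"] by simp
      then show ?thesis
        by (simp add: algebra_simps)
    next
      assume "u = (w + 1) mod m"
      then have "int u = (int w + 1) mod int m"
        by (simp add: zmod_int ac_simps)
      then have "int m dvd (int w + 1) - int u"
        using mod_eq_dvd_iff[of "int w + 1" "int m" "int u"] by simp
      then show ?thesis
        by (simp add: algebra_simps)
    qed
    then obtain i where i: "\<bar>i\<bar> = 1" "int m dvd int w - int u - i"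
      by (metis abs_minus_cancel abs_one)
    have "int m dvd (int v - int w - j) + (int w - int u - i)"
      using i j by (intro dvd_add)
    then have "int m dvd int v - int u - (i + j)"
      by (simp add: algebra_simps)
    moreover have "\<bar>i + j\<bar> \<le> int (length (e # p))"
      using i j by simp
    ultimately show ?case
      by blast
  qed
qed

text \<open>Going round the cycle in either direction gives the upper bound on distances. The
  assumption \<open>2 \<le> m\<close> excludes the one-vertex cycle, which has no arcs.\<close>

lemma cycle_graph_walks:
  assumes "2 \<le> m" and "u < m"
  shows "\<exists>p. pre_digraph.awalk (with_proj (cycle_graph m)) u p ((u + l) mod m) \<and> length p = l"
    and "\<exists>p. pre_digraph.awalk (with_proj (cycle_graph m)) ((u + l) mod m) p u \<and> length p = l"
proof -
  interpret pair_graph "cycle_graph m"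
    by (rule pair_graph_cycle_graph)
  have arc: "(i, (i + 1) mod m) \<in> parcs (cycle_graph m)" "((i + 1) mod m, i) \<in> parcs (cycle_graph m)"
    if "i < m" for i
  proof -
    have "(i + 1) mod m \<noteq> i"
      using that assms by (cases "i + 1 = m") auto
    then show "(i, (i + 1) mod m) \<in> parcs (cycle_graph m)" "((i + 1) mod m, i) \<in> parcs (cycle_graph m)"
      using that assms by (auto simp: cycle_graph_def)
  qed
  have step: "(u + Suc l) mod m = ((u + l) mod m + 1) mod m" for l
    by (simp add: mod_simps)
  have u: "u \<in> pverts (cycle_graph m)"
    using assms by (simp add: cycle_graph_def)
  show "\<exists>p. awalk u p ((u + l) mod m) \<and> length p = l"
  proof (induction l)
    case 0
    then show ?case
      using assms u by (auto simp: awalk_Nil_iff)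
  next
    case (Suc l)
    then obtain p where p: "awalk u p ((u + l) mod m)" "length p = l"
      by blast
    have a: "((u + l) mod m, (u + Suc l) mod m) \<in> parcs (cycle_graph m)"
      unfolding step using arc(1)[of "(u + l) mod m"] assms by simp
    then have "awalk ((u + l) mod m) [((u + l) mod m, (u + Suc l) mod m)] ((u + Suc l) mod m)"
      by (auto simp: awalk_Cons_iff awalk_Nil_iff dest: in_arcsD1 in_arcsD2)
    then have "awalk u (p @ [((u + l) mod m, (u + Suc l) mod m)]) ((u + Suc l) mod m)"
      using p by (auto intro: awalk_appendI)
    then show ?case
      using p by (intro exI[of _ "p @ [((u + l) mod m, (u + Suc l) mod m)]"]) simp
  qed
  show "\<exists>p. awalk ((u + l) mod m) p u \<and> length p = l"
  proof (induction l)
    case 0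
    then show ?case
      using assms u by (auto simp: awalk_Nil_iff)
  next
    case (Suc l)
    then obtain p where p: "awalk ((u + l) mod m) p u" "length p = l"
      by blast
    have a: "((u + Suc l) mod m, (u + l) mod m) \<in> parcs (cycle_graph m)"
      unfolding step using arc(2)[of "(u + l) mod m"] assms by simp
    then have "awalk ((u + Suc l) mod m) (((u + Suc l) mod m, (u + l) mod m) # p) u"
      using p by (auto simp: awalk_Cons_iff dest: in_arcsD1)
    then show ?case
      using p by (intro exI[of _ "((u + Suc l) mod m, (u + l) mod m) # p"]) simp
  qed
qed

text \<open>The alternatives are the two arcs between \<open>u\<close> and \<open>v\<close>, of
  lengths \<open>v - u\<close> and \<open>u + m - v\<close>, written additively to avoid truncated
  subtraction.\<close>

lemma graph_dist_cycle_graph_le_iff: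
  assumes "u < v" and "v < m"
  shows "graph_dist (cycle_graph m) u v \<le> ereal (real k) \<longleftrightarrow> v \<le> u + k \<or> u + m \<le> v + k"
    and "graph_dist (cycle_graph m) v u \<le> ereal (real k) \<longleftrightarrow> v \<le> u + k \<or> u + m \<le> v + k"
proof -
  note iff = graph_dist_le_iff[OF pair_graph_cycle_graph]
  have bound: "v \<le> u + k \<or> u + m \<le> v + k" if j: "\<bar>j\<bar> \<le> int k" "int m dvd int v - int u - j" for j
  proof -
    obtain q where q: "int v - int u - j = int m * q"
      using j(2) by (elim dvdE)
    \<comment> \<open>The sign of \<open>q\<close> selects the arc: \<open>q \<le> 0\<close> gives
      \<open>v - u \<le> j\<close>, and \<open>q \<ge> 1\<close> gives
      \<open>v - u - j \<ge> m\<close>.\<close>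
    show ?thesis
    proof (cases "q \<le> 0")
      case True
      then have "int m * q \<le> 0"
        by (simp add: mult_nonneg_nonpos)
      then show ?thesis
        using q j(1) assms by linarith
    next
      case False
      then have "int m * 1 \<le> int m * q"
        by (intro mult_left_mono) auto
      then show ?thesis
        using q j(1) assms by linarith
    qed
  qed
  have m: "2 \<le> m" "u < m"
    using assms by auto
  have fwd: "(u + (v - u)) mod m = v" and bwd: "(v + (u + m - v)) mod m = u"
    using assms by auto
  have uv: "\<exists>p. pre_digraph.awalk (with_proj (cycle_graph m)) u p v \<and> length p = v - u"
    "\<exists>p. pre_digraph.awalk (with_proj (cycle_graph m)) u p v \<and> length p = u + m - v"
    using cycle_graph_walks(1)[OF m, of "v - u"] cycle_graph_walks(2)[OF m(1) assms(2), of "u + m - v"]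
    by (simp_all only: fwd bwd)
  have vu: "\<exists>p. pre_digraph.awalk (with_proj (cycle_graph m)) v p u \<and> length p = v - u"
    "\<exists>p. pre_digraph.awalk (with_proj (cycle_graph m)) v p u \<and> length p = u + m - v"
    using cycle_graph_walks(2)[OF m, of "v - u"] cycle_graph_walks(1)[OF m(1) assms(2), of "u + m - v"]
    by (simp_all only: fwd bwd)
  show "graph_dist (cycle_graph m) u v \<le> ereal (real k) \<longleftrightarrow> v \<le> u + k \<or> u + m \<le> v + k"
    unfolding iff
  proof
    assume "\<exists>p. pre_digraph.awalk (with_proj (cycle_graph m)) u p v \<and> length p \<le> k"
    then obtain p where p: "pre_digraph.awalk (with_proj (cycle_graph m)) u p v" "length p \<le> k"
      by blast
    obtain j where "\<bar>j\<bar> \<le> int (length p)" "int m dvd int v - int u - j"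
      using cycle_graph_walk_displacement[OF p(1)] by blast
    then show "v \<le> u + k \<or> u + m \<le> v + k"
      using p(2) by (intro bound[of j]) auto
  next
    assume "v \<le> u + k \<or> u + m \<le> v + k"
    then have "v - u \<le> k \<or> u + m - v \<le> k"
      by auto
    then show "\<exists>p. pre_digraph.awalk (with_proj (cycle_graph m)) u p v \<and> length p \<le> k"
      using uv(1) uv(2) by metis
  qed
  show "graph_dist (cycle_graph m) v u \<le> ereal (real k) \<longleftrightarrow> v \<le> u + k \<or> u + m \<le> v + k"
    unfolding iff
  proof
    assume "\<exists>p. pre_digraph.awalk (with_proj (cycle_graph m)) v p u \<and> length p \<le> k"
    then obtain p where p: "pre_digraph.awalk (with_proj (cycle_graph m)) v p u" "length p \<le> k"
      by blast
    obtain j where "\<bar>j\<bar> \<le> int (length p)" "int m dvd int u - int v - j"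
      using cycle_graph_walk_displacement[OF p(1)] by blast
    moreover from this have "int m dvd int v - int u - (- j)"
      using dvd_minus_iff[of "int m" "int u - int v - j"] by (simp add: algebra_simps)
    ultimately show "v \<le> u + k \<or> u + m \<le> v + k"
      using p(2) by (intro bound[of "- j"]) auto
  next
    assume "v \<le> u + k \<or> u + m \<le> v + k"
    then have "v - u \<le> k \<or> u + m - v \<le> k"
      by auto
    then show "\<exists>p. pre_digraph.awalk (with_proj (cycle_graph m)) v p u \<and> length p \<le> k"
      using vu(1) vu(2) by metis
  qed
qed

text \<open>
  On \<open>{0..<2 * k + d}\<close> this is non-adjacency in the \<open>k\<close>-th power of the cycle.
\<close>

definition far :: "nat \<Rightarrow> nat \<Rightarrow> nat \<Rightarrow> nat \<Rightarrow> bool" where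
  "far k d u v \<longleftrightarrow> u + k < v \<and> v < u + k + d \<or> v + k < u \<and> u < v + k + d"

text \<open>Writing the number of vertices as \<open>2 * k + d\<close> makes \<open>d\<close> the
  invariant of the reduction. The edgeless case \<open>k = 0\<close> is included, where any two
  distinct vertices are far.\<close>

lemma clique_complex_cycle_power:
  "clique_complex (graph_power (cycle_graph (2 * k + d)) k) = indep_complex {0..<2 * k + d} (far k d)"
proof -
  let ?G = "graph_power (cycle_graph (2 * k + d)) k"
  have verts: "pverts ?G = {0..<2 * k + d}"
    by (simp add: graph_power_def cycle_graph_def)
  have arcs: "(u \<noteq> v \<longrightarrow> (u, v) \<in> parcs ?G) \<longleftrightarrow> \<not> far k d u v" if "u < 2 * k + d" "v < 2 * k + d" for u v
  proof (cases u v rule: linorder_cases)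
    case less
    have "(u, v) \<in> parcs ?G \<longleftrightarrow> graph_dist (cycle_graph (2 * k + d)) u v \<le> ereal (real k)"
      using that less by (simp add: graph_power_def cycle_graph_def)
    then show ?thesis
      unfolding graph_dist_cycle_graph_le_iff(1)[OF less that(2)] using less by (auto simp: far_def)
  next
    case equal
    then show ?thesis
      by (simp add: far_def)
  next
    case greater
    have "(u, v) \<in> parcs ?G \<longleftrightarrow> graph_dist (cycle_graph (2 * k + d)) u v \<le> ereal (real k)"
      using that greater by (simp add: graph_power_def cycle_graph_def)
    then show ?thesis
      unfolding graph_dist_cycle_graph_le_iff(2)[OF greater that(1)] using greater by (auto simp: far_def)
  qed
  have "(\<forall>u\<in>\<sigma>. \<forall>v\<in>\<sigma>. u \<noteq> v \<longrightarrow> (u, v) \<in> parcs ?G) \<longleftrightarrow> (\<forall>u\<in>\<sigma>. \<forall>v\<in>\<sigma>. \<not> far k d u v)"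
    if "\<sigma> \<subseteq> {0..<2 * k + d}" for \<sigma>
    using that by (intro ball_cong refl arcs) auto
  then show ?thesis
    unfolding clique_complex_def indep_complex_def verts by blast
qed

section \<open>Suspensions of independence complexes\<close>

fun susp_adj :: "('a \<Rightarrow> 'a \<Rightarrow> bool) \<Rightarrow> bool + 'a \<Rightarrow> bool + 'a \<Rightarrow> bool" where
  "susp_adj E (Inl a) (Inl b) = (a \<noteq> b)"
| "susp_adj E (Inr a) (Inr b) = E a b"
| "susp_adj E _ _ = False"

text \<open>Independent sets of a disjoint union form a join, and a single edge has the two-point
  complex as its independence complex. So suspending means adding an isolated edge.\<close>

lemma suspension_indep_complex:
  "suspension (indep_complex V E) = indep_complex (UNIV <+> V) (susp_adj E)"
proof (intro equalityI subsetI)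
  fix \<rho> assume "\<rho> \<in> suspension (indep_complex V E)"
  then obtain \<sigma> \<tau> where \<rho>: "\<rho> = \<sigma> <+> \<tau>" and "\<sigma> \<in> two_points" and \<tau>: "\<tau> \<in> indep_complex V E"
    by (auto simp: suspension_def simplicial_join_def)
  then have "\<forall>a\<in>\<sigma>. \<forall>b\<in>\<sigma>. a = b"
    by (auto simp: two_points_def)
  then have "\<not> susp_adj E x y" if "x \<in> \<rho>" "y \<in> \<rho>" for x y
    using that \<tau> unfolding \<rho> by (cases x; cases y) (simp_all add: indep_complex_def Plus_def image_iff)
  moreover have "\<rho> \<subseteq> UNIV <+> V" "finite \<rho>"
    using \<tau> by (auto simp: \<rho> indep_complex_def)
  ultimately show "\<rho> \<in> indep_complex (UNIV <+> V) (susp_adj E)"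
    by (simp add: indep_complex_def)
next
  fix \<rho> assume "\<rho> \<in> indep_complex (UNIV <+> V) (susp_adj E)"
  then have fin: "finite \<rho>" and sub: "\<rho> \<subseteq> UNIV <+> V"
    and adj: "\<And>a b. a \<in> \<rho> \<Longrightarrow> b \<in> \<rho> \<Longrightarrow> \<not> susp_adj E a b"
    by (auto simp: indep_complex_def)
  have "\<rho> = Inl -` \<rho> <+> Inr -` \<rho>"
  proof (rule set_eqI)
    show "x \<in> \<rho> \<longleftrightarrow> x \<in> Inl -` \<rho> <+> Inr -` \<rho>" for x
      by (cases x) auto
  qed
  moreover have "Inl -` \<rho> \<in> two_points"
  proof -
    have "a = b" if "Inl a \<in> \<rho>" "Inl b \<in> \<rho>" for a b
      using adj[OF that] by simp
    then have "\<not> (Inl True \<in> \<rho> \<and> Inl False \<in> \<rho>)"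
      by blast
    then have "Inl -` \<rho> = {} \<or> Inl -` \<rho> = {True} \<or> Inl -` \<rho> = {False}"
      by (auto simp: set_eq_iff) (metis (full_types))+
    then show ?thesis
      by (auto simp: two_points_def)
  qed
  moreover have "Inr -` \<rho> \<in> indep_complex V E"
  proof -
    have "\<not> E a b" if "a \<in> Inr -` \<rho>" "b \<in> Inr -` \<rho>" for a b
      using adj[of "Inr a" "Inr b"] that by simp
    moreover have "finite (Inr -` \<rho> :: 'a set)"
      using fin by (rule finite_vimageI) simp
    moreover have "Inr -` \<rho> \<subseteq> V"
      using sub by auto
    ultimately show ?thesis
      by (simp add: indep_complex_def)
  qed
  ultimately show "\<rho> \<in> suspension (indep_complex V E)"
    unfolding suspension_def simplicial_join_def by blast
qed

text \<open>
  Vertices \<open>a \<le> r\<close> and \<open>b \<ge> r + d\<close> with \<open>a + 2 * r < b\<close> become adjacent because the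
  intervals of \<open>{r + 1..<r + d}\<close> that they leave free are disjoint.
\<close>

lemma indep_complex_far_unfold_first:
  assumes "2 \<le> d" and "d \<le> r"
    and J: "\<And>a b. J a b \<longleftrightarrow> a = 0 \<and> b = r + 1 \<or>
      1 \<le> a \<and> a \<le> r \<and> r + d \<le> b \<and> (a + r < b \<and> b < a + r + d \<or> a + 2 * r < b)"
  shows "geometric_realization (indep_complex {0..<2 * r + d} (far r d)) homotopy_equivalent_space
    geometric_realization (indep_complex ({0..r + 1} \<union> {r + d..<2 * r + d}) (\<lambda>a b. J a b \<or> J b a))"
proof -
  let ?W = "{1..r} \<union> {r + d..<2 * r + d}"
  \<comment> \<open>A vertex \<open>a \<le> r\<close> leaves \<open>r + 1\<close> up to
    \<open>a + r\<close> free, and \<open>a \<ge> r + d\<close> leaves everything from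
    \<open>a - r\<close> on. The maximum keeps the left end in \<open>N\<close>; the right end
    \<open>r + d\<close> lies just past \<open>N\<close> and imposes no bound.\<close>
  let ?f = "\<lambda>a. max (a - r) (r + 1)" and ?g = "\<lambda>a. if a \<le> r then a + r else r + d"
  have "geometric_realization (indep_complex {0..<2 * r + d} (far r d)) homotopy_equivalent_space
      geometric_realization (indep_complex (insert 0 (insert (r + 1) ?W)) (\<lambda>a b. J a b \<or> J b a))"
  proof (rule indep_complex_unfold_star_interval[where N = "{r + 1..<r + d}" and f = ?f and g = ?g])
    show "(\<not> far r d a b) = (?f a \<le> b \<and> b \<le> ?g a)" if "a \<in> ?W" "b \<in> {r + 1..<r + d}" for a b
      using that assms(1,2) by (auto simp: far_def)
    show "(J a b \<or> J b a) = (far r d a b \<or> ?g a < ?f b \<or> ?g b < ?f a)" if "a \<in> ?W" "b \<in> ?W" for a b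
      using that assms(1,2) unfolding J far_def by auto
  qed (use assms(1,2) in \<open>auto simp: far_def J\<close>)
  also have "insert 0 (insert (r + 1) ?W) = {0..r + 1} \<union> {r + d..<2 * r + d}"
    by auto
  finally show ?thesis .
qed

text \<open>The neighbours of \<open>r + d\<close> are now \<open>{1..<d}\<close>, of which
  \<open>1\<close> is kept as the opposite pole. Two vertices \<open>a < b\<close> beyond
  \<open>r + d\<close> become adjacent when their free intervals are disjoint, that is, when
  \<open>a + r < b + d\<close>. For \<open>a \<ge> d\<close> the clause \<open>a + 2 * r < b\<close>
  of \<open>J\<close> is void on the vertex set, where \<open>b < 2 * r + d\<close>.\<close>

lemma indep_complex_far_unfold_second:
  fixes d r :: nat
  assumes "2 \<le> d" and "d \<le> r"
    and J: "\<And>a b. J a b \<longleftrightarrow> a = 0 \<and> b = r + 1 \<or>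
      1 \<le> a \<and> a \<le> r \<and> r + d \<le> b \<and> (a + r < b \<and> b < a + r + d \<or> a + 2 * r < b)"
    and J': "\<And>a b. J' a b \<longleftrightarrow> a = 0 \<and> b = r + 1 \<or> a = 1 \<and> b = r + d \<or>
      d \<le> a \<and> a \<le> r \<and> r + d < b \<and> a + r < b \<and> b < a + r + d \<or>
      r + d < a \<and> a < b \<and> a + r < b + d"
  shows "geometric_realization (indep_complex ({0..r + 1} \<union> {r + d..<2 * r + d}) (\<lambda>a b. J a b \<or> J b a))
      homotopy_equivalent_space
    geometric_realization (indep_complex ({0, 1} \<union> {d..r + 1} \<union> {r + d..<2 * r + d}) (\<lambda>a b. J' a b \<or> J' b a))"
proof -
  let ?W = "{0} \<union> {d..r + 1} \<union> {r + d<..<2 * r + d}"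
  \<comment> \<open>Up to \<open>r + 1\<close> the truncated difference is 0 and the whole of
    \<open>N\<close> is free, \<open>d\<close> being past its end. Beyond \<open>r + d\<close> the
    free part runs from \<open>a - 2 * r\<close>, or from 1 if that is larger, to
    \<open>a - r - d\<close>.\<close>
  let ?f = "\<lambda>a. max 1 (a - 2 * r)" and ?g = "\<lambda>a. if a \<le> r + 1 then d else a - r - d"
  have "geometric_realization (indep_complex ({0..r + 1} \<union> {r + d..<2 * r + d}) (\<lambda>a b. J a b \<or> J b a))
      homotopy_equivalent_space
      geometric_realization (indep_complex (insert (r + d) (insert 1 ?W)) (\<lambda>a b. J' a b \<or> J' b a))"
  proof (rule indep_complex_unfold_star_interval[where N = "{1..<d}" and f = ?f and g = ?g])
    show "(\<not> (J a b \<or> J b a)) = (?f a \<le> b \<and> b \<le> ?g a)" if "a \<in> ?W" "b \<in> {1..<d}" for a b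
      using that assms(1,2) unfolding J by auto
    show "(J' a b \<or> J' b a) = ((J a b \<or> J b a) \<or> ?g a < ?f b \<or> ?g b < ?f a)" if "a \<in> ?W" "b \<in> ?W" for a b
      using that assms(1,2) unfolding J J' by auto
  qed (use assms(1,2) in \<open>auto simp: J J'\<close>)
  also have "insert (r + d) (insert 1 ?W) = {0, 1} \<union> {d..r + 1} \<union> {r + d..<2 * r + d}"
    using assms(1,2) by auto
  finally show ?thesis .
qed

text \<open>The two unfoldings split off the isolated edges \<open>{0, r + 1}\<close> and
  \<open>{1, r + d}\<close>, the poles of the two suspensions. What remains is the same relation
  with \<open>r - d\<close> in place of \<open>r\<close>.\<close>

lemma indep_complex_far_double_suspension:
  assumes "1 \<le> d" and "d \<le> r"
  shows "geometric_realization (indep_complex {0..<2 * r + d} (far r d)) homotopy_equivalent_space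
    geometric_realization (suspension (suspension (indep_complex {0..<2 * (r - d) + d} (far (r - d) d))))"
proof (cases "d = 1")
  \<comment> \<open>For \<open>d = 1\<close> no two vertices are far, so vertex 0 has no neighbours
    to unfold along. Both sides are cones instead, with apexes \<open>0\<close> and
    \<open>Inr (Inr 0)\<close>.\<close>
  case True
  let ?U = "(UNIV :: bool set) <+> ((UNIV :: bool set) <+> {0..<2 * (r - d) + d})" and ?S = "susp_adj (susp_adj (far (r - d) d))"
  have "geometric_realization (indep_complex {0..<2 * r + d} (far r d)) homotopy_equivalent_space
      geometric_realization (indep_complex {0} (far r d))"
    by (rule indep_complex_cone) (use True in \<open>auto simp: far_def\<close>)
  also have "\<dots> homotopy_equivalent_space geometric_realization (indep_complex {Inr (Inr 0)} ?S)"
    by (rule indep_complex_relabel[where \<phi> = "\<lambda>_. Inr (Inr 0)"]) (auto simp: far_def bij_betw_def)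
  also have "\<dots> homotopy_equivalent_space geometric_realization (indep_complex ?U ?S)"
  proof (rule homotopy_equivalent_space_sym[THEN iffD1], rule indep_complex_cone)
    show "\<not> ?S a (Inr (Inr 0)) \<and> \<not> ?S (Inr (Inr 0)) a" for a
      using True by (auto simp: far_def elim!: susp_adj.elims)
  qed (use True in auto)
  finally show ?thesis
    by (simp add: suspension_indep_complex)
next
  case False
  then have d: "2 \<le> d"
    using assms by simp
  define J where "J a b \<longleftrightarrow> a = 0 \<and> b = r + 1 \<or>
      1 \<le> a \<and> a \<le> r \<and> r + d \<le> b \<and> (a + r < b \<and> b < a + r + d \<or> a + 2 * r < b)" for a b
  define J' where "J' a b \<longleftrightarrow> a = 0 \<and> b = r + 1 \<or> a = 1 \<and> b = r + d \<or>
      d \<le> a \<and> a \<le> r \<and> r + d < b \<and> a + r < b \<and> b < a + r + d \<or>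
      r + d < a \<and> a < b \<and> a + r < b + d" for a b
  let ?U = "(UNIV :: bool set) <+> ((UNIV :: bool set) <+> {0..<2 * (r - d) + d})" and ?S = "susp_adj (susp_adj (far (r - d) d))"
  let ?V = "{0, 1} \<union> {d..r + 1} \<union> {r + d..<2 * r + d}"
  \<comment> \<open>The surviving blocks \<open>{d..r}\<close> and
    \<open>{r + d<..<2 * r + d}\<close> are numbered consecutively from 0.\<close>
  define h where "h x = (if x \<le> r - d then x + d else x + 2 * d)" for x
  let ?\<phi> = "case_sum (\<lambda>c. if c then 0 else r + 1) (case_sum (\<lambda>c. if c then 1 else r + d) h)"
  have bij: "bij_betw ?\<phi> ?U ?V"
  proof (rule bij_betwI')
    show "(?\<phi> a = ?\<phi> b) = (a = b)" if "a \<in> ?U" "b \<in> ?U" for a b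
      using that d assms(2) by (auto simp: h_def split: if_splits)
    show "?\<phi> a \<in> ?V" if "a \<in> ?U" for a
      using that d assms(2) by (auto simp: h_def split: if_splits)
    show "\<exists>a\<in>?U. b = ?\<phi> a" if b: "b \<in> ?V" for b
    proof -
      consider "b = 0" | "b = r + 1" | "b = 1" | "b = r + d" | "d \<le> b" "b \<le> r" | "r + d < b" "b < 2 * r + d"
        using b by force
      then show ?thesis
      proof cases
        case 1
        then show ?thesis by (intro bexI[of _ "Inl True"]) auto
      next
        case 2
        then show ?thesis by (intro bexI[of _ "Inl False"]) auto
      next
        case 3
        then show ?thesis by (intro bexI[of _ "Inr (Inl True)"]) auto
      next
        case 4
        then show ?thesis by (intro bexI[of _ "Inr (Inl False)"]) auto
      next
        case 5
        then show ?thesis using d assms(2) by (intro bexI[of _ "Inr (Inr (b - d))"]) (auto simp: h_def)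
      next
        case 6
        then show ?thesis using d assms(2) by (intro bexI[of _ "Inr (Inr (b - 2 * d))"]) (auto simp: h_def)
      qed
    qed
  qed
  have h_range: "d \<le> h x \<and> h x \<le> r \<or> r + d < h x" for x
    using assms(2) by (auto simp: h_def)
  have h_ne: "h x \<noteq> 0" "h x \<noteq> 1" "h x \<noteq> r + 1" "h x \<noteq> r + d" for x
    using h_range[of x] d assms(2) by auto
  have J'h: "J' (h x) (h y) \<longleftrightarrow>
      h x \<le> r \<and> r + d < h y \<and> h x + r < h y \<and> h y < h x + r + d \<or>
      r + d < h x \<and> h x < h y \<and> h x + r < h y + d" for x y
    using h_range[of x] h_ne[of x] h_ne[of y] unfolding J'_def by auto
  obtain k where r: "r = k + d"
    using assms(2) by (metis le_Suc_ex add.commute)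
  have k: "r - d = k"
    using r by simp
  have far_h: "far (r - d) d x y \<longleftrightarrow> J' (h x) (h y) \<or> J' (h y) (h x)"
    if xy: "x < 2 * (r - d) + d" "y < 2 * (r - d) + d" for x y
  proof -
    consider "x \<le> k" "y \<le> k" | "x \<le> k" "k < y" | "k < x" "y \<le> k" | "k < x" "k < y"
      by linarith
    then show ?thesis
    proof cases
      case 1
      then have h: "h x = x + d" "h y = y + d"
        by (simp_all add: h_def k)
      have "\<not> far k d x y"
        using 1 by (simp add: far_def)
      then show ?thesis
        unfolding J'h unfolding h k using 1 r by (simp add: ac_simps)
    next
      case 2
      then have h: "h x = x + d" "h y = y + 2 * d"
        by (simp_all add: h_def k)
      have "far k d x y \<longleftrightarrow> x + k < y \<and> y < x + k + d"
        using 2 by (simp add: far_def)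
      then show ?thesis
        unfolding J'h unfolding h k using 2 r by (simp add: ac_simps)
    next
      case 3
      then have h: "h x = x + 2 * d" "h y = y + d"
        by (simp_all add: h_def k)
      have "far k d x y \<longleftrightarrow> y + k < x \<and> x < y + k + d"
        using 3 by (simp add: far_def)
      then show ?thesis
        unfolding J'h unfolding h k using 3 r by (simp add: ac_simps)
    next
      case 4
      then have h: "h x = x + 2 * d" "h y = y + 2 * d"
        by (simp_all add: h_def k)
      \<comment> \<open>The upper bound in \<open>far\<close> is automatic, since both vertices
        exceed \<open>k\<close> and lie below \<open>2 * k + d\<close>.\<close>
      have "far k d x y \<longleftrightarrow> x + k < y \<or> y + k < x"
        using 4 xy by (auto simp: far_def k)
      then show ?thesis
        unfolding J'h unfolding h k using 4 r by auto
    qed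
  qed
  have isolated: "\<not> J' (h x) c \<and> \<not> J' c (h x)" if "c \<in> {0, 1, r + 1, r + d}" for c x
    using that h_range[of x] d assms(2) unfolding J'_def by auto
  have special: "J' a b \<longleftrightarrow> a = 0 \<and> b = r + 1 \<or> a = 1 \<and> b = r + d"
    if "a \<in> {0, 1, r + 1, r + d}" "b \<in> {0, 1, r + 1, r + d}" for a b
    using that d assms(2) unfolding J'_def by auto
  have adj: "?S a b \<longleftrightarrow> J' (?\<phi> a) (?\<phi> b) \<or> J' (?\<phi> b) (?\<phi> a)" if "a \<in> ?U" "b \<in> ?U" for a b
    using that d assms(2) by (auto simp: far_h isolated special split: if_splits)
  have "geometric_realization (indep_complex {0..<2 * r + d} (far r d)) homotopy_equivalent_space
      geometric_realization (indep_complex ({0..r + 1} \<union> {r + d..<2 * r + d}) (\<lambda>a b. J a b \<or> J b a))"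
    by (rule indep_complex_far_unfold_first[OF d assms(2) J_def])
  also have "\<dots> homotopy_equivalent_space geometric_realization (indep_complex ?V (\<lambda>a b. J' a b \<or> J' b a))"
    by (rule indep_complex_far_unfold_second[OF d assms(2) J_def J'_def])
  also have "\<dots> homotopy_equivalent_space geometric_realization (indep_complex ?U ?S)"
  proof -
    have "finite ?U"
      by simp
    from indep_complex_relabel[of ?\<phi> ?U ?V ?S "\<lambda>a b. J' a b \<or> J' b a", OF bij this]
    have "geometric_realization (indep_complex ?U ?S) homotopy_equivalent_space
        geometric_realization (indep_complex ?V (\<lambda>a b. J' a b \<or> J' b a))"
      using adj by blast
    then show ?thesis
      using homotopy_equivalent_space_sym by blast
  qed
  finally show ?thesis
    by (simp add: suspension_indep_complex)
qed

theorem corollary6p6: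
  fixes n r :: nat
  assumes "n \<ge> 3" and "real n / 3 \<le> real r" and "real r < real n / 2"
  shows "geometric_realization (clique_complex (graph_power (cycle_graph n) r))
           homotopy_equivalent_space
         geometric_realization (suspension (suspension
           (clique_complex (graph_power (cycle_graph (4 * r - n)) (3 * r - n)))))
       \<and> suspension (suspension
           (clique_complex (graph_power (cycle_graph (4 * r - n)) (3 * r - n)))) =
         suspension (suspension
           (clique_complex (graph_power (cycle_graph (n - 2 * (n - 2 * r))) (r - (n - 2 * r)))))"
proof -
  define d where "d = n - 2 * r"
  have "real n \<le> real (3 * r)" "real (2 * r) < real n"
    using assms by simp_all
  then have "n \<le> 3 * r" "2 * r < n"
    by linarith+
  then have d: "1 \<le> d" "d \<le> r" and n: "n = 2 * r + d"
    by (auto simp: d_def)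
  \<comment> \<open>Since \<open>d \<le> r\<close>, none of the subtractions truncates, and the two
    descriptions of the smaller power have equal parameters.\<close>
  have "4 * r - n = 2 * (r - d) + d" "3 * r - n = r - d" "n - 2 * (n - 2 * r) = 2 * (r - d) + d"
      "r - (n - 2 * r) = r - d"
    using d by (auto simp: n)
  then show ?thesis
    using indep_complex_far_double_suspension[OF d] by (simp add: clique_complex_cycle_power n)
qed

end
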